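(* (Uniqueness of the $\mathcal A[\delta]$-normal form.) Let $\delta\in\{1,2\}$, let $\Gamma$ and $\Lambda[\delta]$ be fixed, let $(c_1,c_2)$ be the conductor of $\Gamma$ and $c=\max\{c_1,c_2\}$. If $\phi\in N$, then $$N^c\cap\mathcal A^c[\delta](j^c\phi)=\{j^c\phi\},$$ where $\mathcal A^c[\delta](j^c\phi)$ denotes the orbit of $j^c\phi$ under $\mathcal A^c[\delta]$.
   Context: A bigerm $\phi=[\phi_1,\phi_2]$ is a pair of parametrizations $\phi_i=(\phi_{i1},\phi_{i2}):(\mathbb C,0)\to(\mathbb C^2,0)$, with parameter $t_i$, of the two (distinct) branches of a reduced germ of plane analytic curve with exactly two irreducible components; $m_i$ is the multiplicity of the $i$-th branch and $m=(m_1,m_2)$ is the multiplicity of $\phi$. $\mathcal B^k$ is the vector space of $k$-jets of bigerms, and $j^k$ denotes the $k$-jet. The group $\mathcal A=\mathrm{Aut}(\mathbb C\{t_1\})\times\mathrm{Aut}(\mathbb C\{t_2\})\times\mathrm{Aut}(\mathbb C\{x,y\})$ (analytic coordinate changes) acts on bigerms by $(\rho_1,\rho_2,\sigma)\cdot\phi=[\sigma\circ\phi_1\circ\rho_1^{-1},\ \sigma\circ\phi_2\circ\rho_2^{-1}]$. $\mathcal A[2]$ is the subgroup of $(\rho_1,\rho_2,\sigma)$ with $j^1\rho_i=t_i$ ($i=1,2$) and $j^1\sigma=(x+by,y)$ for some $b\in\mathbb C$; $\mathcal A[1]$ is the subgroup of $\mathcal A[2]$ where $b=0$. $\mathcal A^k[\delta]$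 is the Lie group of $k$-jets of elements of $\mathcal A[\delta]$, acting on $\mathcal B^k$. Puiseux form. The index $\delta=1$ refers to distinct tangents and $\delta=2$ to equal tangents of the two branches. A bigerm is in Puiseux form if $\phi_1=(t_1^{m_1},\sum_{i>m_1}a_{1i}t_1^i)$ and $\phi_2=(\sum_{i>m_2}a_{2i}t_2^i,\ t_2^{m_2})$ when $\delta=1$, respectively $\phi_2=(t_2^{m_2},\sum_{i>m_2}a_{2i}t_2^i)$ when $\delta=2$. Invariants. With $\mathrm{ord}\,0=\infty$: for $\eta\in\mathbb C\{x,y\}$, $\nu_i(\eta)=\mathrm{ord}_{t_i}(\eta\circ\phi_i)$, and the semigroup of values is $\Gamma=\{(\nu_1(\eta),\nu_2(\eta));\ \eta\in\mathbb C\{x,y\}\}$. For a differential $\omega=\eta_1dx+\eta_2dy$ put $\omega\circ\phi_i=\eta_1(\phi_i)\phi_{i1}'+\eta_2(\phi_i)\phi_{i2}'$, $\nu_i(\omega)=\mathrm{ord}_{t_i}(\omega\circ\phi_i)+1$ and $\nu(\omega)=(\nu_1(\omega),\nu_2(\omega))$. Let $$\Omega[\delta]=\{\eta_1dx+(\beta(\delta-1)y+\eta_2)dy;\ \eta_1,\eta_2\in(x,y)^2\mathbb C\{x,y\},\ \beta\in\mathbb C\},\qquad \Lambda[\delta]=\{\nu(\omega)-m;\ \omega\in\Omega[\delta]\}.$$ $\Sigma_{\Gamma,\Lambda[\delta]}$ is the (finite dimensional) set of bigerms in Puiseux form of case $\delta$, with all terms of order at most $c$, having the given $\Gamma$ and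 the given $\Lambda[\delta]$. Fibers and maximal points. For $(a_1,a_2)\in\mathbb N^2$ and $\{i,l\}=\{1,2\}$, $F_i(a_1,a_2)=\{(b_1,b_2)\in\Lambda[\delta];\ b_i=a_i,\ b_l>a_l\}$. $M$ is the set of points $(k_1,k_2)\in\Lambda[\delta]$ with $F_1(k_1,k_2)=F_2(k_1,k_2)=\emptyset$. For $j\in\mathbb N$, $\underline{j}=(j,j)$. Normal forms. $N$ is the set of $\varphi=[\varphi_1,\varphi_2]\in\Sigma_{\Gamma,\Lambda[\delta]}$ such that $\varphi_1=(t_1^{m_1},\sum a_{1j}t_1^j)$, the sum being over $j>m_1$ with $\underline{j}\notin M$ and $F_1(\underline{j})=\emptyset$, and $\varphi_2=(\sum a_{2j}t_2^j,\ t_2^{m_2})$ if $\delta=1$, $\varphi_2=(t_2^{m_2},\sum a_{2j}t_2^j)$ if $\delta=2$, the sum being over $j>m_2$ with $F_2(\underline{j})=\emptyset$. $N^k=j^k(N)$. *)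

theory Defs
  imports "HOL-Analysis.Analysis"
begin

section \<open>Convergent power series\<close>

text \<open>
  A series in two variables is a power series in \<open>x\<close> whose coefficients are power series
  in \<open>y\<close>: the coefficient of \<open>x^i y^j\<close> in \<open>\<eta>\<close> is \<open>fps_nth (fps_nth \<eta> i) j\<close>.
\<close>

type_synonym ser2 = "complex fps fps"

definition X2 :: ser2 where "X2 = fps_X"

definition Y2 :: ser2 where "Y2 = fps_const fps_X"

definition const2 :: "complex \<Rightarrow> ser2" where "const2 b = fps_const (fps_const b)"

definition coeff2 :: "ser2 \<Rightarrow> nat \<Rightarrow> nat \<Rightarrow> complex" where
  "coeff2 \<eta> i j = fps_nth (fps_nth \<eta> i) j"

definition conv1 :: "complex fps set" where
  "conv1 = {f. fps_conv_radius f > 0}"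

definition conv2 :: "ser2 set" where
  "conv2 = {\<eta>. \<exists>r>0. (\<lambda>(i, j). norm (coeff2 \<eta> i j) * r ^ (i + j)) summable_on UNIV}"

definition ord :: "complex fps \<Rightarrow> enat" where
  "ord f = (if f = 0 then \<infinity> else enat (subdegree f))"

text \<open>
  The ideal \<open>(x, y)^2\<close> of the ring of convergent series, given by its generators.
\<close>

definition max_ideal_sq :: "ser2 set" where
  "max_ideal_sq = {X2 ^ 2 * f + X2 * Y2 * g + Y2 ^ 2 * h | f g h.
     f \<in> conv2 \<and> g \<in> conv2 \<and> h \<in> conv2}"


section \<open>Parametrizations and substitution\<close>

type_synonym param = "complex fps \<times> complex fps"

type_synonym bigerm = "param \<times> param"

text \<open>
  The substituted series must have no constant term; then only the monomials kept in the
  finite sums contribute to the coefficient in question.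
\<close>

definition subst2 :: "ser2 \<Rightarrow> param \<Rightarrow> complex fps" where
  "subst2 \<eta> p = Abs_fps (\<lambda>n. \<Sum>i\<le>n. \<Sum>j\<le>n. coeff2 \<eta> i j * fps_nth (fst p ^ i * snd p ^ j) n)"

definition subst22 :: "ser2 \<Rightarrow> ser2 \<times> ser2 \<Rightarrow> ser2" where
  "subst22 \<eta> \<sigma> = Abs_fps (\<lambda>k. Abs_fps (\<lambda>l.
     \<Sum>i\<le>k + l. \<Sum>j\<le>k + l. coeff2 \<eta> i j * coeff2 (fst \<sigma> ^ i * snd \<sigma> ^ j) k l))"

definition comp22 :: "ser2 \<times> ser2 \<Rightarrow> ser2 \<times> ser2 \<Rightarrow> ser2 \<times> ser2" where
  "comp22 \<sigma> \<tau> = (subst22 (fst \<sigma>) \<tau>, subst22 (snd \<sigma>) \<tau>)"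

definition params :: "param set" where
  "params = {p. fst p \<in> conv1 \<and> snd p \<in> conv1 \<and> fps_nth (fst p) 0 = 0 \<and> fps_nth (snd p) 0 = 0}"

text \<open>Multiplicity of a branch, read off from a (primitive) parametrization of it.\<close>

definition mult :: "param \<Rightarrow> nat" where
  "mult p = the_enat (min (ord (fst p)) (ord (snd p)))"


section \<open>Bigerms\<close>

definition unit2 :: "ser2 \<Rightarrow> bool" where
  "unit2 u \<longleftrightarrow> u \<in> conv2 \<and> (\<exists>v\<in>conv2. u * v = 1)"

definition irreducible2 :: "ser2 \<Rightarrow> bool" where
  "irreducible2 f \<longleftrightarrow> f \<in> conv2 \<and> f \<noteq> 0 \<and> \<not> unit2 f \<and>
     (\<forall>g\<in>conv2. \<forall>h\<in>conv2. f = g * h \<longrightarrow> unit2 g \<or> unit2 h)"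

definition associated2 :: "ser2 \<Rightarrow> ser2 \<Rightarrow> bool" where
  "associated2 f g \<longleftrightarrow> (\<exists>u. unit2 u \<and> g = u * f)"

definition primitive :: "param \<Rightarrow> bool" where
  "primitive p \<longleftrightarrow> \<not> (\<exists>q1\<in>conv1. \<exists>q2\<in>conv1. \<exists>\<tau>\<in>conv1.
     fps_nth \<tau> 0 = 0 \<and> fps_nth \<tau> 1 = 0 \<and> p = (fps_compose q1 \<tau>, fps_compose q2 \<tau>))"

text \<open>
  \<open>p\<close> parametrizes the branch \<open>f = 0\<close> (for irreducible \<open>f\<close>). A constant \<open>p\<close> is not primitive.
\<close>

definition parametrizes :: "param \<Rightarrow> ser2 \<Rightarrow> bool" where
  "parametrizes p f \<longleftrightarrow> p \<in> params \<and> primitive p \<and> subst2 f p = 0"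

text \<open>The curve underlying a bigerm is \<open>f1 * f2 = 0\<close>.\<close>

definition bigerms :: "bigerm set" where
  "bigerms = {(p1, p2). \<exists>f1 f2. irreducible2 f1 \<and> irreducible2 f2 \<and> \<not> associated2 f1 f2 \<and>
     parametrizes p1 f1 \<and> parametrizes p2 f2}"


section \<open>Coordinate changes, their jets, and the actions\<close>

definition Aut1 :: "complex fps set" where
  "Aut1 = {\<rho>. \<rho> \<in> conv1 \<and> fps_nth \<rho> 0 = 0 \<and>
     (\<exists>\<rho>'\<in>conv1. fps_nth \<rho>' 0 = 0 \<and> fps_compose \<rho> \<rho>' = fps_X \<and> fps_compose \<rho>' \<rho> = fps_X)}"

definition maps2 :: "(ser2 \<times> ser2) set" where
  "maps2 = {\<sigma>. fst \<sigma> \<in> conv2 \<and> snd \<sigma> \<in> conv2 \<and> coeff2 (fst \<sigma>) 0 0 = 0 \<and> coeff2 (snd \<sigma>) 0 0 = 0}"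

definition Aut2 :: "(ser2 \<times> ser2) set" where
  "Aut2 = {\<sigma>\<in>maps2. \<exists>\<sigma>'\<in>maps2. comp22 \<sigma> \<sigma>' = (X2, Y2) \<and> comp22 \<sigma>' \<sigma> = (X2, Y2)}"

type_synonym coord_change = "complex fps \<times> complex fps \<times> (ser2 \<times> ser2)"

definition A_group :: "coord_change set" where
  "A_group = Aut1 \<times> Aut1 \<times> Aut2"

definition act_param :: "complex fps \<Rightarrow> ser2 \<times> ser2 \<Rightarrow> param \<Rightarrow> param" where
  "act_param \<rho> \<sigma> p = (let q = (fps_compose (fst p) (fps_inv \<rho>), fps_compose (snd p) (fps_inv \<rho>))
     in (subst2 (fst \<sigma>) q, subst2 (snd \<sigma>) q))"

definition act :: "coord_change \<Rightarrow> bigerm \<Rightarrow> bigerm" where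
  "act = (\<lambda>(\<rho>1, \<rho>2, \<sigma>) (p1, p2). (act_param \<rho>1 \<sigma> p1, act_param \<rho>2 \<sigma> p2))"

text \<open>Jets are represented by their polynomial representatives of degree at most \<open>k\<close>.\<close>

definition jet1 :: "nat \<Rightarrow> complex fps \<Rightarrow> complex fps" where
  "jet1 k f = fps_cutoff (Suc k) f"

definition jet2 :: "nat \<Rightarrow> ser2 \<Rightarrow> ser2" where
  "jet2 k \<eta> = Abs_fps (\<lambda>i. Abs_fps (\<lambda>j. if i + j \<le> k then coeff2 \<eta> i j else 0))"

definition jetB :: "nat \<Rightarrow> bigerm \<Rightarrow> bigerm" where
  "jetB k = (\<lambda>((a, b), (c, d)). ((jet1 k a, jet1 k b), (jet1 k c, jet1 k d)))"

definition jetA :: "nat \<Rightarrow> coord_change \<Rightarrow> coord_change" where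
  "jetA k = (\<lambda>(\<rho>1, \<rho>2, (\<sigma>1, \<sigma>2)). (jet1 k \<rho>1, jet1 k \<rho>2, (jet2 k \<sigma>1, jet2 k \<sigma>2)))"

definition A_sub :: "nat \<Rightarrow> coord_change set" where
  "A_sub \<delta> = {(\<rho>1, \<rho>2, (\<sigma>1, \<sigma>2)) \<in> A_group.
     jet1 1 \<rho>1 = fps_X \<and> jet1 1 \<rho>2 = fps_X \<and>
     (\<exists>b. (\<delta> = 1 \<longrightarrow> b = 0) \<and> jet2 1 \<sigma>1 = X2 + const2 b * Y2) \<and> jet2 1 \<sigma>2 = Y2}"

definition A_jets :: "nat \<Rightarrow> nat \<Rightarrow> coord_change set" where
  "A_jets k \<delta> = jetA k ` A_sub \<delta>"

text \<open>
  For \<open>k \<ge> 1\<close> the \<open>k\<close>-jet of \<open>act g p\<close> depends only on the \<open>k\<close>-jets of \<open>g\<close> and \<open>p\<close>, so the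
  action on jets is computed on polynomial representatives.
\<close>

definition jet_act :: "nat \<Rightarrow> coord_change \<Rightarrow> bigerm \<Rightarrow> bigerm" where
  "jet_act k g p = jetB k (act g p)"

definition jet_orbit :: "nat \<Rightarrow> nat \<Rightarrow> bigerm \<Rightarrow> bigerm set" where
  "jet_orbit k \<delta> p = {jet_act k g p | g. g \<in> A_jets k \<delta>}"


section \<open>Values of functions and differentials\<close>

definition value_semigroup :: "bigerm \<Rightarrow> (enat \<times> enat) set" where
  "value_semigroup = (\<lambda>(p1, p2). {(ord (subst2 \<eta> p1), ord (subst2 \<eta> p2)) | \<eta>. \<eta> \<in> conv2})"

text \<open>A pair \<open>(\<eta>1, \<eta>2)\<close> stands for the differential \<open>\<eta>1 dx + \<eta>2 dy\<close>.\<close>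

definition pullback :: "ser2 \<times> ser2 \<Rightarrow> param \<Rightarrow> complex fps" where
  "pullback \<omega> p = subst2 (fst \<omega>) p * fps_deriv (fst p) + subst2 (snd \<omega>) p * fps_deriv (snd p)"

definition form_value :: "ser2 \<times> ser2 \<Rightarrow> param \<Rightarrow> enat" where
  "form_value \<omega> p = ord (pullback \<omega> p) + 1"

definition Omega :: "nat \<Rightarrow> (ser2 \<times> ser2) set" where
  "Omega \<delta> = {(\<eta>1, const2 (\<beta> * of_nat (\<delta> - 1)) * Y2 + \<eta>2) | \<eta>1 \<eta>2 \<beta>.
     \<eta>1 \<in> max_ideal_sq \<and> \<eta>2 \<in> max_ideal_sq}"

text \<open>
  The subtraction of \<open>mult\<close> never truncates, since every \<open>\<omega>\<close> in \<open>Omega \<delta>\<close> has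
  \<open>form_value \<omega> p \<ge> 2 * mult p\<close>.
\<close>

definition Lambda :: "nat \<Rightarrow> bigerm \<Rightarrow> (enat \<times> enat) set" where
  "Lambda \<delta> = (\<lambda>(p1, p2).
     {(form_value \<omega> p1 - enat (mult p1), form_value \<omega> p2 - enat (mult p2)) | \<omega>. \<omega> \<in> Omega \<delta>})"

definition is_conductor :: "(enat \<times> enat) set \<Rightarrow> nat \<times> nat \<Rightarrow> bool" where
  "is_conductor \<Gamma> = (\<lambda>(c1, c2).
     (\<forall>a\<ge>c1. \<forall>b\<ge>c2. (enat a, enat b) \<in> \<Gamma>) \<and>
     (\<forall>d1 d2. (\<forall>a\<ge>d1. \<forall>b\<ge>d2. (enat a, enat b) \<in> \<Gamma>) \<longrightarrow> c1 \<le> d1 \<and> c2 \<le> d2))"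

definition conductor :: "(enat \<times> enat) set \<Rightarrow> nat \<times> nat" where
  "conductor \<Gamma> = (THE c. is_conductor \<Gamma> c)"


section \<open>Puiseux forms and normal forms\<close>

text \<open>
  In case \<open>\<delta> = 1\<close> (distinct tangents) the second branch has tangent \<open>x = 0\<close>, so its two
  components swap roles; in case \<open>\<delta> = 2\<close> both tangents are \<open>y = 0\<close>.
\<close>

definition lead_comp :: "nat \<Rightarrow> param \<Rightarrow> complex fps" where
  "lead_comp \<delta> p2 = (if \<delta> = 1 then snd p2 else fst p2)"

definition free_comp :: "nat \<Rightarrow> param \<Rightarrow> complex fps" where
  "free_comp \<delta> p2 = (if \<delta> = 1 then fst p2 else snd p2)"

definition puiseux_form :: "nat \<Rightarrow> bigerm \<Rightarrow> bool" where
  "puiseux_form \<delta> = (\<lambda>(p1, p2).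
     fst p1 = fps_X ^ mult p1 \<and> (\<forall>j\<le>mult p1. fps_nth (snd p1) j = 0) \<and>
     lead_comp \<delta> p2 = fps_X ^ mult p2 \<and> (\<forall>j\<le>mult p2. fps_nth (free_comp \<delta> p2) j = 0))"

definition puiseux_stratum :: "nat \<Rightarrow> (enat \<times> enat) set \<Rightarrow> (enat \<times> enat) set \<Rightarrow> bigerm set" where
  "puiseux_stratum \<delta> \<Gamma> L = {\<phi> \<in> bigerms. puiseux_form \<delta> \<phi> \<and>
     (\<forall>n > max (fst (conductor \<Gamma>)) (snd (conductor \<Gamma>)).
        fps_nth (fst (fst \<phi>)) n = 0 \<and> fps_nth (snd (fst \<phi>)) n = 0 \<and>
        fps_nth (fst (snd \<phi>)) n = 0 \<and> fps_nth (snd (snd \<phi>)) n = 0) \<and>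
     value_semigroup \<phi> = \<Gamma> \<and> Lambda \<delta> \<phi> = L}"

definition fiber1 :: "(enat \<times> enat) set \<Rightarrow> nat \<times> nat \<Rightarrow> (enat \<times> enat) set" where
  "fiber1 L a = {(b1, b2) \<in> L. b1 = enat (fst a) \<and> b2 > enat (snd a)}"

definition fiber2 :: "(enat \<times> enat) set \<Rightarrow> nat \<times> nat \<Rightarrow> (enat \<times> enat) set" where
  "fiber2 L a = {(b1, b2) \<in> L. b2 = enat (snd a) \<and> b1 > enat (fst a)}"

definition maximal_points :: "(enat \<times> enat) set \<Rightarrow> (nat \<times> nat) set" where
  "maximal_points L = {k. (enat (fst k), enat (snd k)) \<in> L \<and> fiber1 L k = {} \<and> fiber2 L k = {}}"

definition normal_forms :: "nat \<Rightarrow> (enat \<times> enat) set \<Rightarrow> (enat \<times> enat) set \<Rightarrow> bigerm set" where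
  "normal_forms \<delta> \<Gamma> L = {(p1, p2) \<in> puiseux_stratum \<delta> \<Gamma> L.
     (\<forall>j > mult p1. fps_nth (snd p1) j \<noteq> 0 \<longrightarrow> (j, j) \<notin> maximal_points L \<and> fiber1 L (j, j) = {}) \<and>
     (\<forall>j > mult p2. fps_nth (free_comp \<delta> p2) j \<noteq> 0 \<longrightarrow> fiber2 L (j, j) = {})}"

end

theory Submission
  imports Defs
begin

text \<open>
  Suppose two normal forms \<open>\<phi>\<close> and \<open>\<psi>\<close> lie in one orbit, \<open>\<psi>\<close> being the jet of \<open>(\<rho>, \<sigma>) \<cdot> \<phi>\<close>, and
  let \<open>k\<close> be the first order at which they differ. On functions, with \<open>P\<close> the pullback along a branch
  of \<open>\<phi>\<close>, \<open>S = \<sigma>\<^sup>* - 1\<close> and \<open>T = \<rho>\<^sup>* - 1\<close>, this says that \<open>P S = T P + \<Delta> t\<^sup>k\<close> modulo \<open>t\<^sup>k\<^sup>+\<^sup>1\<close>, where \<open>\<Delta>\<close> depends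
  only on the linear part of its argument. Iterating, and summing with the coefficients of the
  logarithm, turns \<open>T\<close> into a derivation \<open>\<epsilon> d/dt\<close> and \<open>S\<close> into a vector field with components \<open>D x\<close>
  and \<open>D y\<close>. The first-order term survives up to a shift of its \<open>x\<close>-component that occurs only
  when \<open>\<Delta> y \<noteq> 0\<close> and has no influence on the lowest order below. Pulling back the
  differential \<open>D y dx - D x dy\<close>, an element of \<open>\<Omega>[\<delta>]\<close>, eliminates \<open>\<epsilon>\<close>; its value minus \<open>m\<close> equals \<open>k\<close>
  on the branches where \<open>\<phi>\<close> and \<open>\<psi>\<close> differ at order \<open>k\<close>, and is larger on the others. Such a point
  of \<open>\<Lambda>[\<delta>]\<close> contradicts the vanishing conditions in the definition of \<open>N\<close>.
\<close>

section \<open>Divisibility by powers of the variable\<close>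

text \<open>Congruences modulo a power of the parameter are stated throughout as divisibility of a
  difference by \<open>fps_X ^ n\<close>; this criterion turns them into equalities of
  coefficients.\<close>

lemma X_power_dvd_iff:
  "fps_X ^ n dvd (f :: 'a::comm_ring_1 fps) \<longleftrightarrow> (\<forall>i<n. fps_nth f i = 0)"
proof
  assume "\<forall>i<n. fps_nth f i = 0"
  then have "f = fps_X ^ n * fps_shift n f"
    by (simp add: fps_eq_iff fps_X_power_mult_nth)
  then show "fps_X ^ n dvd f" by (metis dvd_triv_left)
qed (auto simp: dvd_def fps_X_power_mult_nth)

lemma X_dvd_iff: "fps_X dvd (f :: 'a::comm_ring_1 fps) \<longleftrightarrow> fps_nth f 0 = 0"
  using X_power_dvd_iff[of 1 f] by simp

lemma X_power_dvd_mono: "fps_X ^ n dvd (f :: 'a::comm_ring_1 fps) \<Longrightarrow> m \<le> n \<Longrightarrow> fps_X ^ m dvd f"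
  by (auto simp: X_power_dvd_iff)

lemma nth_eq_if_X_power_dvd_diff:
  "fps_X ^ n dvd f - (g :: 'a::comm_ring_1 fps) \<Longrightarrow> i < n \<Longrightarrow> fps_nth f i = fps_nth g i"
  by (auto simp: X_power_dvd_iff)

lemma X_power_dvd_power_mult_power:
  fixes f g :: "'a::comm_ring_1 fps"
  assumes "fps_nth f 0 = 0" "fps_nth g 0 = 0"
  shows "fps_X ^ (i + j) dvd f ^ i * g ^ j"
  using assms by (auto simp: power_add X_dvd_iff intro!: mult_dvd_mono dvd_power_same)

lemma nth_power_mult_power_eq_0:
  fixes f g :: "'a::comm_ring_1 fps"
  assumes "fps_nth f 0 = 0" "fps_nth g 0 = 0" "n < i + j"
  shows "fps_nth (f ^ i * g ^ j) n = 0"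
  using X_power_dvd_power_mult_power[OF assms(1,2), of i j] assms(3) by (auto simp: X_power_dvd_iff)

lemma X_power_dvd_compose:
  fixes h r :: "'a::idom fps"
  assumes "fps_X ^ n dvd h" "fps_nth r 0 = 0"
  shows "fps_X ^ n dvd h oo r"
proof -
  from assms obtain u where "h = fps_X ^ n * u" by (auto simp: dvd_def)
  then have "h oo r = r ^ n * (u oo r)"
    using assms by (simp add: fps_compose_mult_distrib fps_X_power_compose)
  moreover have "fps_X ^ n dvd r ^ n"
    using assms by (simp add: X_dvd_iff dvd_power_same)
  ultimately show ?thesis by simp
qed

lemma X_power_dvd_compose_diff:
  fixes f g r :: "'a::idom fps"
  assumes "fps_X ^ n dvd f - g" "fps_nth r 0 = 0"
  shows "fps_X ^ n dvd (f oo r) - (g oo r)"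
  using X_power_dvd_compose[OF assms] by (simp add: fps_compose_sub_distrib)

lemma X_power_dvd_deriv:
  "fps_X ^ Suc n dvd (f :: complex fps) \<Longrightarrow> fps_X ^ n dvd fps_deriv f"
  by (auto simp: X_power_dvd_iff simp del: power_Suc)

lemma dvd_diff_trans:
  fixes a b c e :: "'a::comm_ring_1"
  assumes "e dvd a - b" "e dvd b - c"
  shows "e dvd a - c"
  using dvd_add[OF assms] by simp

lemma dvd_diff_add_trans:
  fixes a b c d e :: "'a::comm_ring_1"
  assumes "e dvd a - (b + c)" "e dvd b - d"
  shows "e dvd a - (d + c)"
  using dvd_add[OF assms] by (simp add: algebra_simps)

lemma dvd_mult_diff:
  fixes a b c d e :: "'a::comm_ring_1"
  assumes "e dvd a - b" "e dvd c - d"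
  shows "e dvd a * c - b * d"
proof -
  have "a * c - b * d = (a - b) * c + b * (c - d)" by (simp add: algebra_simps)
  then show ?thesis using assms by (metis dvd_add dvd_mult dvd_mult2)
qed

text \<open>With \<open>h = fps_X ^ n * u\<close> and \<open>r = fps_X * (1 + fps_X * w)\<close>,
  both \<open>h\<close> and \<open>h oo r\<close> are \<open>fps_X ^ n\<close> times series with the
  same constant term. This gain of one order is what makes \<open>comp_step\<close> nilpotent modulo
  powers of the variable.\<close>

lemma X_power_dvd_diff_compose_X_plus:
  fixes h r :: "complex fps"
  assumes "fps_X ^ n dvd h" "fps_nth r 0 = 0" "fps_nth r 1 = 1"
  shows "fps_X ^ Suc n dvd (h oo r) - h"
proof -
  from assms obtain u where h: "h = fps_X ^ n * u" by (auto simp: dvd_def)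
  from assms have "fps_X ^ 2 dvd r - fps_X"
    by (auto simp: X_power_dvd_iff less_2_cases_iff)
  then obtain w where "r - fps_X = fps_X ^ 2 * w" by (auto simp: dvd_def)
  then have r: "r = fps_X * (1 + fps_X * w)" by (simp add: algebra_simps power2_eq_square)
  have "(h oo r) - h = fps_X ^ n * ((1 + fps_X * w) ^ n * (u oo r) - u)"
    using assms by (simp add: h fps_compose_mult_distrib fps_X_power_compose algebra_simps)
      (simp add: r power_mult_distrib)
  moreover have "fps_X dvd ((1 + fps_X * w) ^ n * (u oo r) - u)"
    by (simp add: X_dvd_iff fps_power_zeroth)
  ultimately show ?thesis by (simp add: power_Suc2 del: power_Suc)
qed

section \<open>Substitution into a parametrization\<close>

text \<open>The formal part of \<open>params\<close>: substitution is studied among formal series,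
  where it only asks for vanishing constant terms.\<close>

definition admissible :: "param \<Rightarrow> bool" where
  "admissible p \<longleftrightarrow> fps_nth (fst p) 0 = 0 \<and> fps_nth (snd p) 0 = 0"

text \<open>A product of \<open>i + j\<close> series without constant term has order at least
  \<open>i + j\<close>, so every bound \<open>M\<close> from \<open>n\<close> on gives the same
  coefficient. One bound can then serve all coefficients up to \<open>M\<close>.\<close>

lemma subst2_nth_le:
  assumes "admissible p" "n \<le> M"
  shows "fps_nth (subst2 \<eta> p) n =
    (\<Sum>i\<le>M. \<Sum>j\<le>M. coeff2 \<eta> i j * fps_nth (fst p ^ i * snd p ^ j) n)"
proof -
  have z: "fps_nth (fst p ^ i * snd p ^ j) n = 0" if "n < i \<or> n < j" for i j
    using that assms by (intro nth_power_mult_power_eq_0) (auto simp: admissible_def)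
  have "(\<Sum>i\<le>M. \<Sum>j\<le>M. coeff2 \<eta> i j * fps_nth (fst p ^ i * snd p ^ j) n) =
    (\<Sum>i\<le>n. \<Sum>j\<le>M. coeff2 \<eta> i j * fps_nth (fst p ^ i * snd p ^ j) n)"
    using assms(2) by (intro sum.mono_neutral_right) (auto simp: z)
  also have "\<dots> = (\<Sum>i\<le>n. \<Sum>j\<le>n. coeff2 \<eta> i j * fps_nth (fst p ^ i * snd p ^ j) n)"
    using assms(2) by (intro sum.cong refl sum.mono_neutral_right) (auto simp: z)
  finally show ?thesis by (simp add: subst2_def)
qed

lemma X_power_dvd_subst2_diff_sum:
  assumes "admissible p"
  shows "fps_X ^ Suc M dvd subst2 \<eta> p -
    (\<Sum>i\<le>M. \<Sum>j\<le>M. fps_const (coeff2 \<eta> i j) * (fst p ^ i * snd p ^ j))"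
  using subst2_nth_le[OF assms, of _ M \<eta>]
  by (auto simp: X_power_dvd_iff fps_sum_nth less_Suc_eq_le simp del: power_Suc)

text \<open>Summing over the powers of \<open>y\<close> first leaves one-variable compositions,
  whose multiplicativity is known; \<open>subst2_mult\<close> builds on this.\<close>

lemma subst2_nth_compose:
  assumes "admissible p" "n \<le> M"
  shows "fps_nth (subst2 \<eta> p) n = fps_nth (\<Sum>i\<le>M. (fps_nth \<eta> i oo snd p) * fst p ^ i) n"
proof -
  have "fps_nth ((fps_nth \<eta> i oo snd p) * fst p ^ i) n =
     fps_nth (\<Sum>j\<le>M. fps_const (coeff2 \<eta> i j) * (fst p ^ i * snd p ^ j)) n" for i
  proof -
    have "fps_X ^ Suc M dvd (fps_nth \<eta> i oo snd p) - (\<Sum>j\<le>M. fps_const (coeff2 \<eta> i j) * snd p ^ j)"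
      unfolding X_power_dvd_iff
    proof (intro allI impI)
      fix m assume m: "m < Suc M"
      have "fps_nth (fps_nth \<eta> i oo snd p) m = (\<Sum>j=0..m. coeff2 \<eta> i j * fps_nth (snd p ^ j) m)"
        by (simp add: fps_compose_nth coeff2_def)
      also have "\<dots> = (\<Sum>j\<le>M. coeff2 \<eta> i j * fps_nth (snd p ^ j) m)"
        using assms m by (intro sum.mono_neutral_left)
          (auto simp: admissible_def startsby_zero_power_prefix)
      finally show "fps_nth ((fps_nth \<eta> i oo snd p) -
          (\<Sum>j\<le>M. fps_const (coeff2 \<eta> i j) * snd p ^ j)) m = 0"
        by (simp add: fps_sum_nth)
    qed
    then have "fps_X ^ Suc M dvd (fps_nth \<eta> i oo snd p) * fst p ^ i -
        (\<Sum>j\<le>M. fps_const (coeff2 \<eta> i j) * snd p ^ j) * fst p ^ i"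
      by (intro dvd_mult_diff) auto
    from nth_eq_if_X_power_dvd_diff[OF this, of n] assms(2)
    show ?thesis by (simp add: sum_distrib_right sum_distrib_left mult_ac)
  qed
  then show ?thesis
    using assms by (simp add: subst2_nth_le[OF assms] fps_sum_nth)
qed

text \<open>Modulo \<open>fps_X ^ Suc n\<close> the factors are polynomials in \<open>fst p\<close>
  with coefficients \<open>E i\<close> and \<open>F a\<close>; sorting their product by
  \<open>i + a\<close> gives the Cauchy product.\<close>

lemma subst2_mult:
  assumes "admissible p"
  shows "subst2 (\<eta> * \<theta>) p = subst2 \<eta> p * subst2 \<theta> p"
proof (rule fps_ext)
  fix n
  define E where "E i = (fps_nth \<eta> i oo snd p)" for i
  define F where "F i = (fps_nth \<theta> i oo snd p)" for i
  have c0: "fps_nth (fst p) 0 = 0" "fps_nth (snd p) 0 = 0"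
    using assms by (auto simp: admissible_def)
  have z: "fps_nth (E i * F a * fst p ^ (i + a)) n = 0" if "\<not> i + a \<le> n" for i a
  proof -
    have "fps_X ^ (i + a) dvd E i * F a * fst p ^ (i + a)"
      using c0 by (intro dvd_mult dvd_power_same) (simp add: X_dvd_iff)
    with that show ?thesis by (simp add: X_power_dvd_iff)
  qed
  have "fps_X ^ Suc n dvd subst2 \<eta> p - (\<Sum>i\<le>n. E i * fst p ^ i)"
    using subst2_nth_compose[OF assms, of _ n \<eta>] by (auto simp: X_power_dvd_iff E_def less_Suc_eq_le simp del: power_Suc)
  moreover have "fps_X ^ Suc n dvd subst2 \<theta> p - (\<Sum>i\<le>n. F i * fst p ^ i)"
    using subst2_nth_compose[OF assms, of _ n \<theta>] by (auto simp: X_power_dvd_iff F_def less_Suc_eq_le simp del: power_Suc)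
  ultimately have "fps_X ^ Suc n dvd subst2 \<eta> p * subst2 \<theta> p -
      (\<Sum>i\<le>n. E i * fst p ^ i) * (\<Sum>i\<le>n. F i * fst p ^ i)"
    by (rule dvd_mult_diff)
  from nth_eq_if_X_power_dvd_diff[OF this, of n]
  have "fps_nth (subst2 \<eta> p * subst2 \<theta> p) n =
      (\<Sum>i\<le>n. \<Sum>a\<le>n. fps_nth (E i * F a * fst p ^ (i + a)) n)"
    by (simp add: sum_product fps_sum_nth power_add mult_ac)
  also have "\<dots> = (\<Sum>(i, a)\<in>{..n} \<times> {..n}. fps_nth (E i * F a * fst p ^ (i + a)) n)"
    by (simp add: sum.cartesian_product)
  \<comment> \<open>Terms with \<open>i + a > n\<close> have order above \<open>n\<close>, so the
    square of indices shrinks to a triangle.\<close>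
  also have "\<dots> = (\<Sum>(i, a)\<in>{(i, a). i + a \<le> n}. fps_nth (E i * F a * fst p ^ (i + a)) n)"
    by (rule sum.mono_neutral_right) (auto, use z in blast)
  also have "\<dots> = (\<Sum>k\<le>n. \<Sum>i\<le>k. fps_nth (E i * F (k - i) * fst p ^ (i + (k - i))) n)"
    by (rule sum.triangle_reindex_eq)
  also have "\<dots> = (\<Sum>k\<le>n. fps_nth ((\<Sum>i\<le>k. E i * F (k - i)) * fst p ^ k) n)"
    by (simp add: sum_distrib_right fps_sum_nth)
  also have "\<dots> = fps_nth (\<Sum>k\<le>n. (fps_nth (\<eta> * \<theta>) k oo snd p) * fst p ^ k) n"
    using c0 by (simp add: fps_sum_nth E_def F_def fps_mult_nth fps_compose_sum_distrib
      fps_compose_mult_distrib atLeast0AtMost)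
  finally show "fps_nth (subst2 (\<eta> * \<theta>) p) n = fps_nth (subst2 \<eta> p * subst2 \<theta> p) n"
    by (simp add: subst2_nth_compose[OF assms order_refl])
qed

section \<open>Linearity of the pullback and its values on the coordinates\<close>

lemma subst2_add: "subst2 (\<eta> + \<theta>) p = subst2 \<eta> p + subst2 \<theta> p"
  by (simp add: fps_eq_iff subst2_def coeff2_def algebra_simps sum.distrib)

lemma subst2_minus: "subst2 (- \<eta>) p = - subst2 \<eta> p"
  by (simp add: fps_eq_iff subst2_def coeff2_def sum_negf)

lemma subst2_diff: "subst2 (\<eta> - \<theta>) p = subst2 \<eta> p - subst2 \<theta> p"
  using subst2_add[of \<eta> "- \<theta>" p] by (simp add: subst2_minus)

lemma subst2_sum: "subst2 (\<Sum>i\<in>I. f i) p = (\<Sum>i\<in>I. subst2 (f i) p)"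
proof (induction I rule: infinite_finite_induct)
qed (simp_all add: subst2_add, simp_all add: fps_eq_iff subst2_def coeff2_def)

lemma coeff2_const2_mult [simp]: "coeff2 (const2 c * \<eta>) i j = c * coeff2 \<eta> i j"
  by (simp add: coeff2_def const2_def)

lemma coeff2_const2: "coeff2 (const2 c) i j = (if i = 0 \<and> j = 0 then c else 0)"
  by (simp add: coeff2_def const2_def)

lemma subst2_const2_mult: "subst2 (const2 c * \<eta>) p = fps_const c * subst2 \<eta> p"
  by (simp add: fps_eq_iff subst2_def sum_distrib_left mult.assoc)

lemma coeff2_X2: "coeff2 X2 i j = (if i = 1 \<and> j = 0 then 1 else 0)"
  by (simp add: coeff2_def X2_def)

lemma coeff2_Y2: "coeff2 Y2 i j = (if i = 0 \<and> j = 1 then 1 else 0)"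
  by (simp add: coeff2_def Y2_def)

lemma coeff2_1: "coeff2 1 i j = (if i = 0 \<and> j = 0 then 1 else 0)"
  by (simp add: coeff2_def)

lemma sum_sum_single:
  fixes f :: "nat \<Rightarrow> nat \<Rightarrow> 'a::comm_monoid_add"
  assumes "finite A" "finite B" "\<And>i j. i \<in> A \<Longrightarrow> j \<in> B \<Longrightarrow> (i, j) \<noteq> (a, b) \<Longrightarrow> f i j = 0" "a \<in> A" "b \<in> B"
  shows "(\<Sum>i\<in>A. \<Sum>j\<in>B. f i j) = f a b"
proof -
  have "(\<Sum>i\<in>A. \<Sum>j\<in>B. f i j) = (\<Sum>(i, j)\<in>A \<times> B. f i j)"
    by (simp add: sum.cartesian_product)
  also have "\<dots> = (\<Sum>(i, j)\<in>{(a, b)}. f i j)"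
    using assms by (intro sum.mono_neutral_right) auto
  finally show ?thesis by simp
qed

lemma subst2_1: assumes "admissible p" shows "subst2 1 p = 1"
proof (rule fps_ext)
  fix n
  show "fps_nth (subst2 1 p) n = fps_nth 1 n"
    unfolding subst2_def fps_nth_Abs_fps
    by (subst sum_sum_single[where a = 0 and b = 0]) (auto simp: coeff2_1)
qed

lemma subst2_X2: assumes "admissible p" shows "subst2 X2 p = fst p"
proof (rule fps_ext)
  fix n
  have "fps_nth (subst2 X2 p) n =
    (\<Sum>i\<le>Suc n. \<Sum>j\<le>Suc n. coeff2 X2 i j * fps_nth (fst p ^ i * snd p ^ j) n)"
    by (rule subst2_nth_le[OF assms]) simp
  also have "\<dots> = fps_nth (fst p) n"
    by (subst sum_sum_single[where a = 1 and b = 0]) (auto simp: coeff2_X2)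
  finally show "fps_nth (subst2 X2 p) n = fps_nth (fst p) n" .
qed

lemma subst2_Y2: assumes "admissible p" shows "subst2 Y2 p = snd p"
proof (rule fps_ext)
  fix n
  have "fps_nth (subst2 Y2 p) n =
    (\<Sum>i\<le>Suc n. \<Sum>j\<le>Suc n. coeff2 Y2 i j * fps_nth (fst p ^ i * snd p ^ j) n)"
    by (rule subst2_nth_le[OF assms]) simp
  also have "\<dots> = fps_nth (snd p) n"
    by (subst sum_sum_single[where a = 0 and b = 1]) (auto simp: coeff2_Y2)
  finally show "fps_nth (subst2 Y2 p) n = fps_nth (snd p) n" .
qed

lemma subst2_power:
  assumes "admissible p"
  shows "subst2 (\<eta> ^ n) p = subst2 \<eta> p ^ n"
  by (induction n) (simp_all add: subst2_1 subst2_mult assms)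

text \<open>Up to order \<open>n\<close> the pullback is a polynomial expression, and composition
  with \<open>r\<close> commutes with such expressions and preserves congruences.\<close>

lemma subst2_compose:
  assumes "admissible p" "fps_nth r 0 = 0"
  shows "subst2 \<eta> p oo r = subst2 \<eta> (fst p oo r, snd p oo r)"
proof (rule fps_ext)
  fix n
  let ?s = "\<lambda>q. \<Sum>i\<le>n. \<Sum>j\<le>n. fps_const (coeff2 \<eta> i j) * (fst q ^ i * snd q ^ j)"
  let ?q = "(fst p oo r, snd p oo r)"
  have q: "admissible ?q" using assms by (simp add: admissible_def)
  have "fps_X ^ Suc n dvd (subst2 \<eta> p oo r) - (?s p oo r)"
    by (intro X_power_dvd_compose_diff X_power_dvd_subst2_diff_sum assms)
  then have "fps_nth (subst2 \<eta> p oo r) n = fps_nth (?s p oo r) n"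
    by (rule nth_eq_if_X_power_dvd_diff) simp
  also have "?s p oo r = ?s ?q"
    using assms by (simp add: fps_compose_sum_distrib fps_compose_mult_distrib fps_compose_power)
  also have "fps_nth (?s ?q) n = fps_nth (subst2 \<eta> ?q) n"
    using nth_eq_if_X_power_dvd_diff[OF X_power_dvd_subst2_diff_sum[OF q, of n \<eta>], of n] by simp
  finally show "fps_nth (subst2 \<eta> p oo r) n = fps_nth (subst2 \<eta> ?q) n" .
qed

section \<open>Logarithm of a substitution\<close>

text \<open>The operator \<open>T = \<rho>\<^sup>* - 1\<close>, with \<open>r\<close> in the role of
  \<open>\<rho>\<close>.\<close>

definition comp_step :: "complex fps \<Rightarrow> complex fps \<Rightarrow> complex fps" where
  "comp_step r h = (h oo r) - h"

text \<open>The coefficients of the power series of log(1 + z).\<close>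

definition log_coeff :: "nat \<Rightarrow> complex" where
  "log_coeff n = (- 1) ^ (n - 1) / of_nat n"

text \<open>Truncation of log(1 + \<open>T\<close>). For \<open>r\<close> tangent to the identity,
  the omitted terms vanish modulo \<open>fps_X ^ N\<close>, because \<open>T\<close> raises
  orders.\<close>

definition comp_log :: "nat \<Rightarrow> complex fps \<Rightarrow> complex fps \<Rightarrow> complex fps" where
  "comp_log N r h = (\<Sum>n=1..N. fps_const (log_coeff n) * (comp_step r ^^ n) h)"

section \<open>Binomial coefficients as polynomials in the upper argument\<close>

definition binom_poly :: "nat \<Rightarrow> complex poly" where
  "binom_poly j = smult (1 / fact j) (\<Prod>i=0..<j. [:- of_nat i, 1:])"

lemma pderiv_sum: "pderiv (\<Sum>i\<in>I. f i) = (\<Sum>i\<in>I. pderiv (f i))"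
  by (induction I rule: infinite_finite_induct) (simp_all add: pderiv_add)

lemma poly_binom_poly: "poly (binom_poly j) (of_nat s) = of_nat (s choose j)"
  by (simp add: binom_poly_def poly_prod binomial_gbinomial gbinomial_prod_rev)

lemma poly_binom_poly_0: "poly (binom_poly j) 0 = (if j = 0 then 1 else 0)"
  using poly_binom_poly[of j 0] by (cases j) auto

text \<open>The derivative at 0 is the value there of the product without its factor s. The
  remaining factors are -1, ..., -(j-1), and division by j! leaves the logarithm
  coefficient.\<close>

lemma poly_pderiv_binom_poly_0:
  "poly (pderiv (binom_poly j)) 0 = (if j = 0 then 0 else log_coeff j)"
proof (cases j)
  case 0
  then show ?thesis by (simp add: binom_poly_def)
next
  case (Suc l)
  define q :: "complex poly" where "q = (\<Prod>i=0..<l. [:- of_nat (Suc i), 1:])"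
  have "binom_poly j = smult (1 / fact j) ([:0, 1:] * q)"
    unfolding binom_poly_def Suc q_def prod.atLeast0_lessThan_Suc_shift by (simp add: o_def)
  then have "poly (pderiv (binom_poly j)) 0 = poly q 0 / fact j"
    by (simp add: pderiv_smult pderiv_mult pderiv_pCons)
  also have "poly q 0 = (- 1) ^ l * fact l"
    unfolding q_def by (induction l) (auto simp: poly_prod algebra_simps)
  finally show ?thesis by (simp add: Suc log_coeff_def)
qed

section \<open>Orders and iterates of a substitution step\<close>

lemma X_power_dvd_comp_step:
  assumes "fps_nth r 0 = 0" "fps_nth r 1 = 1" "fps_X ^ n dvd h"
  shows "fps_X ^ Suc n dvd comp_step r h"
  unfolding comp_step_def using assms by (intro X_power_dvd_diff_compose_X_plus)

lemma X_power_dvd_comp_step_funpow: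
  assumes "fps_nth r 0 = 0" "fps_nth r 1 = 1"
  shows "fps_X ^ n dvd (comp_step r ^^ n) h"
  by (induction n) (use X_power_dvd_comp_step[OF assms] in auto)

lemma comp_step_sum:
  "comp_step r (\<Sum>i\<in>I. f i) = (\<Sum>i\<in>I. comp_step r (f i))"
  by (simp add: comp_step_def fps_compose_sum_distrib sum_subtractf)

lemma comp_step_diff: "comp_step r (f - g) = comp_step r f - comp_step r g"
  by (simp add: comp_step_def fps_compose_sub_distrib)

lemma comp_step_add: "comp_step r (f + g) = comp_step r f + comp_step r g"
  by (simp add: comp_step_def fps_compose_add_distrib)

lemma comp_step_const_mult:
  assumes "fps_nth r 0 = 0"
  shows "comp_step r (fps_const c * f) = fps_const c * comp_step r f"
  using assms by (simp add: comp_step_def fps_compose_mult_distrib algebra_simps)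

text \<open>Composition with \<open>r\<close> is \<open>1 + T\<close>, so this is the binomial
  theorem, proved by Pascal's rule.\<close>

lemma compose_funpow_binomial:
  assumes "fps_nth r 0 = 0"
  shows "((\<lambda>f. f oo r) ^^ s) h = (\<Sum>j\<le>s. fps_const (of_nat (s choose j)) * (comp_step r ^^ j) h)"
proof (induction s)
  case (Suc s)
  let ?T = "\<lambda>j. (comp_step r ^^ j) h"
  have "((\<lambda>f. f oo r) ^^ Suc s) h = (\<Sum>j\<le>s. fps_const (of_nat (s choose j)) * ?T j) oo r"
    by (simp only: Suc funpow.simps o_apply)
  also have "\<dots> = (\<Sum>j\<le>s. fps_const (of_nat (s choose j)) * ?T j) +
      comp_step r (\<Sum>j\<le>s. fps_const (of_nat (s choose j)) * ?T j)"
    unfolding comp_step_def[of r "sum _ _"] by simp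
  also have "comp_step r (\<Sum>j\<le>s. fps_const (of_nat (s choose j)) * ?T j) =
      (\<Sum>j\<le>s. fps_const (of_nat (s choose j)) * ?T (Suc j))"
    by (simp add: comp_step_sum comp_step_const_mult assms)
  \<comment> \<open>The added term carries \<open>s choose Suc s\<close>, which is zero; it lets the
    sum be split at index 0 and matched with the shifted one.\<close>
  also have "(\<Sum>j\<le>s. fps_const (of_nat (s choose j)) * ?T j) =
      (\<Sum>j\<le>Suc s. fps_const (of_nat (s choose j)) * ?T j)"
    by simp
  also have "\<dots> = ?T 0 + (\<Sum>j\<le>s. fps_const (of_nat (s choose Suc j)) * ?T (Suc j))"
    by (subst sum.atMost_Suc_shift) simp
  also have "\<dots> + (\<Sum>j\<le>s. fps_const (of_nat (s choose j)) * ?T (Suc j)) =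
      ?T 0 + (\<Sum>j\<le>s. fps_const (of_nat (Suc s choose Suc j)) * ?T (Suc j))"
    by (simp add: sum.distrib[symmetric] algebra_simps flip: fps_const_add)
  also have "\<dots> = (\<Sum>j\<le>Suc s. fps_const (of_nat (Suc s choose j)) * ?T j)"
    by (subst sum.atMost_Suc_shift) simp
  finally show ?case .
qed simp

text \<open>
  Modulo a power of the variable, the coefficients of the iterates of a substitution are polynomials
  in the number of iterations; the logarithm is the derivative of this family at zero.
\<close>

definition iterate_poly :: "nat \<Rightarrow> complex fps \<Rightarrow> complex fps \<Rightarrow> nat \<Rightarrow> complex poly" where
  "iterate_poly N r h n = (\<Sum>j\<le>N. smult (fps_nth ((comp_step r ^^ j) h) n) (binom_poly j))"

text \<open>The truncation at \<open>N\<close> and the binomial expansion up to \<open>s\<close>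
  agree: terms beyond \<open>N\<close> have order above \<open>n\<close>, and terms beyond
  \<open>s\<close> have binomial coefficient zero.\<close>

lemma poly_iterate_poly:
  assumes "fps_nth r 0 = 0" "fps_nth r 1 = 1" "n < N"
  shows "poly (iterate_poly N r h n) (of_nat s) = fps_nth (((\<lambda>f. f oo r) ^^ s) h) n"
proof -
  let ?f = "\<lambda>j. fps_nth ((comp_step r ^^ j) h) n * of_nat (s choose j)"
  have z: "fps_nth ((comp_step r ^^ j) h) n = 0" if "N < j" for j
    using X_power_dvd_comp_step_funpow[OF assms(1,2), of j h] assms(3) that
    by (auto simp: X_power_dvd_iff)
  have "poly (iterate_poly N r h n) (of_nat s) = (\<Sum>j\<le>N. ?f j)"
    by (simp add: iterate_poly_def poly_sum poly_binom_poly)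
  also have "\<dots> = (\<Sum>j\<le>max N s. ?f j)"
    by (rule sum.mono_neutral_left) (auto simp: z)
  also have "\<dots> = (\<Sum>j\<le>s. ?f j)"
    by (rule sum.mono_neutral_right) auto
  finally show ?thesis
    by (simp add: compose_funpow_binomial assms fps_sum_nth mult_ac)
qed

lemma poly_iterate_poly_0: "poly (iterate_poly N r h n) 0 = fps_nth h n"
proof -
  have "poly (iterate_poly N r h n) 0 = (\<Sum>j\<le>N. if j = 0 then fps_nth h n else 0)"
    unfolding iterate_poly_def poly_sum by (intro sum.cong) (auto simp: poly_binom_poly_0)
  then show ?thesis by simp
qed

lemma poly_pderiv_iterate_poly_0:
  "poly (pderiv (iterate_poly N r h n)) 0 = fps_nth (comp_log N r h) n"
proof -
  have "poly (pderiv (iterate_poly N r h n)) 0 =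
      (\<Sum>j\<le>N. fps_nth ((comp_step r ^^ j) h) n * (if j = 0 then 0 else log_coeff j))"
    by (simp add: iterate_poly_def pderiv_sum pderiv_smult poly_sum poly_pderiv_binom_poly_0)
  also have "\<dots> = (\<Sum>j=1..N. fps_nth ((comp_step r ^^ j) h) n * (if j = 0 then 0 else log_coeff j))"
    by (rule sum.mono_neutral_right) auto
  finally show ?thesis by (simp add: comp_log_def fps_sum_nth mult_ac)
qed

section \<open>The truncated logarithm as a derivation\<close>

lemma poly_eqI_of_nat:
  fixes p q :: "complex poly"
  assumes "\<And>s::nat. poly p (of_nat s) = poly q (of_nat s)"
  shows "p = q"
proof (rule ccontr)
  assume "p \<noteq> q"
  then have "finite {x. poly (p - q) x = 0}"
    by (intro poly_roots_finite) auto
  moreover have "range of_nat \<subseteq> {x. poly (p - q) x = 0}"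
    using assms by auto
  ultimately have "finite (range (of_nat :: nat \<Rightarrow> complex))"
    by (rule finite_subset[rotated])
  then show False
    by (simp add: finite_image_iff inj_on_def)
qed

lemma compose_funpow_mult:
  fixes r :: "complex fps"
  assumes "fps_nth r 0 = 0"
  shows "((\<lambda>f. f oo r) ^^ s) (f * g) = ((\<lambda>f. f oo r) ^^ s) f * ((\<lambda>f. f oo r) ^^ s) g"
  by (induction s) (simp_all add: fps_compose_mult_distrib assms)

text \<open>Iterates of a substitution are multiplicative, so the Cauchy product formula for
  \<open>iterate_poly\<close> holds at every natural number and hence as an identity of polynomials.
  Its derivative at 0 is the Leibniz rule.\<close>

lemma comp_log_mult:
  assumes "fps_nth r 0 = 0" "fps_nth r 1 = 1"
  shows "fps_X ^ N dvd comp_log N r (f * g) - (comp_log N r f * g + f * comp_log N r g)"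
  unfolding X_power_dvd_iff
proof (intro allI impI)
  fix n assume n: "n < N"
  let ?q = "iterate_poly N r"
  have "?q (f * g) n = (\<Sum>i=0..n. ?q f i * ?q g (n - i))"
  proof (rule poly_eqI_of_nat)
    fix s :: nat
    show "poly (?q (f * g) n) (of_nat s) = poly (\<Sum>i=0..n. ?q f i * ?q g (n - i)) (of_nat s)"
      using n by (simp add: poly_iterate_poly[OF assms] poly_sum compose_funpow_mult[OF assms(1)]
        fps_mult_nth)
  qed
  then have "poly (pderiv (?q (f * g) n)) 0 =
      (\<Sum>i=0..n. poly (pderiv (?q f i * ?q g (n - i))) 0)"
    by (simp add: pderiv_sum poly_sum)
  also have "\<dots> = fps_nth (comp_log N r f * g + f * comp_log N r g) n"
    by (simp add: pderiv_mult poly_iterate_poly_0 poly_pderiv_iterate_poly_0 fps_mult_nth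
        sum.distrib[symmetric]) (simp add: mult_ac add_ac)
  finally show "fps_nth (comp_log N r (f * g) - (comp_log N r f * g + f * comp_log N r g)) n = 0"
    by (simp add: poly_pderiv_iterate_poly_0)
qed

lemma comp_step_funpow_add:
  "(comp_step r ^^ n) (f + g) = (comp_step r ^^ n) f + (comp_step r ^^ n) g"
  by (induction n) (simp_all add: comp_step_add)

lemma comp_step_funpow_const_mult:
  "fps_nth r 0 = 0 \<Longrightarrow> (comp_step r ^^ n) (fps_const c * f) = fps_const c * (comp_step r ^^ n) f"
  by (induction n) (simp_all add: comp_step_const_mult)

lemma comp_log_add: "comp_log N r (f + g) = comp_log N r f + comp_log N r g"
  by (simp add: comp_log_def comp_step_funpow_add algebra_simps sum.distrib)

lemma comp_log_const_mult:
  assumes "fps_nth r 0 = 0"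
  shows "comp_log N r (fps_const c * f) = fps_const c * comp_log N r f"
  by (simp add: comp_log_def comp_step_funpow_const_mult[OF assms] sum_distrib_left mult.left_commute)

lemma X_power_dvd_comp_log:
  assumes "fps_nth r 0 = 0" "fps_nth r 1 = 1" "fps_X ^ n dvd h"
  shows "fps_X ^ n dvd comp_log N r h"
proof -
  have "fps_X ^ n dvd (comp_step r ^^ i) h" for i
  proof (induction i)
    case (Suc i)
    from X_power_dvd_comp_step[OF assms(1,2) this] show ?case
      by (simp add: X_power_dvd_mono del: power_Suc)
  qed (use assms in simp)
  then show ?thesis unfolding comp_log_def by (intro dvd_sum dvd_mult)
qed

text \<open>A derivation is determined by its value on the variable: the Leibniz rule settles
  powers, linearity settles polynomials, and the remainder has high order.\<close>

lemma comp_log_deriv: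
  assumes "fps_nth r 0 = 0" "fps_nth r 1 = 1"
  shows "fps_X ^ N dvd comp_log N r h - comp_log N r fps_X * fps_deriv h"
proof -
  let ?E = "comp_log N r"
  have pow: "fps_X ^ N dvd ?E (fps_X ^ i) - ?E fps_X * fps_deriv (fps_X ^ i)" for i
  proof (induction i)
    case 0
    have "comp_log N r 1 = 0"
    proof -
      have "(comp_step r ^^ Suc n) 1 = 0" for n
        by (induction n) (simp_all add: comp_step_def)
      then have "(comp_step r ^^ n) 1 = 0" if "n \<in> {1..N}" for n
        using that by (cases n) auto
      then show ?thesis unfolding comp_log_def by (intro sum.neutral) auto
    qed
    then show ?case by simp
  next
    case (Suc i)
    have "?E (fps_X ^ Suc i) - ?E fps_X * fps_deriv (fps_X ^ Suc i) =
      (?E (fps_X * fps_X ^ i) - (?E fps_X * fps_X ^ i + fps_X * ?E (fps_X ^ i))) +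
      fps_X * (?E (fps_X ^ i) - ?E fps_X * fps_deriv (fps_X ^ i))"
      by (simp add: algebra_simps)
    also have "fps_X ^ N dvd \<dots>"
      by (intro dvd_add comp_log_mult assms dvd_mult Suc)
    finally show ?case .
  qed
  \<comment> \<open>Degree \<open>N\<close> itself is kept, so that the derivative of
    \<open>h - g\<close> still has order at least \<open>N\<close>.\<close>
  define g where "g = (\<Sum>i\<le>N. fps_const (fps_nth h i) * fps_X ^ i)"
  have g: "fps_nth g i = (if i \<le> N then fps_nth h i else 0)" for i
    by (simp add: g_def fps_sum_nth mult_delta_right)
  have "?E g - ?E fps_X * fps_deriv g =
      (\<Sum>i\<le>N. fps_const (fps_nth h i) * (?E (fps_X ^ i) - ?E fps_X * fps_deriv (fps_X ^ i)))"
  proof -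
    have "?E (\<Sum>i\<in>I. fps_const (c i) * fps_X ^ i) = (\<Sum>i\<in>I. fps_const (c i) * ?E (fps_X ^ i))"
      if "finite I" for I and c :: "nat \<Rightarrow> complex"
      using that
    proof (induction I rule: finite_induct)
      case empty
      show ?case using comp_log_const_mult[OF assms(1), of N 0 0] by simp
    qed (simp add: comp_log_add comp_log_const_mult[OF assms(1)])
    then have "?E g = (\<Sum>i\<le>N. fps_const (fps_nth h i) * ?E (fps_X ^ i))"
      by (simp add: g_def)
    moreover have "fps_deriv g = (\<Sum>i\<le>N. fps_const (fps_nth h i) * fps_deriv (fps_X ^ i))"
      by (simp add: g_def fps_deriv_sum del: fps_deriv_power)
    ultimately show ?thesis
      by (simp add: sum_distrib_left sum_subtractf algebra_simps del: fps_deriv_power)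
  qed
  also have "fps_X ^ N dvd \<dots>" by (intro dvd_sum dvd_mult pow)
  finally have 1: "fps_X ^ N dvd ?E g - ?E fps_X * fps_deriv g" .
  have "fps_X ^ N dvd h - g" by (simp add: X_power_dvd_iff g)
  from X_power_dvd_comp_log[OF assms this]
  have 2: "fps_X ^ N dvd ?E (h - g)" .
  have 3: "fps_X ^ N dvd fps_deriv (h - g)" by (simp add: X_power_dvd_iff g)
  have "?E h - ?E fps_X * fps_deriv h =
      (?E g - ?E fps_X * fps_deriv g) + ?E (h - g) - ?E fps_X * fps_deriv (h - g)"
    using comp_log_add[of N r "h - g" g] by (simp add: algebra_simps)
  also have "fps_X ^ N dvd \<dots>" by (intro dvd_add dvd_diff 1 2 dvd_mult 3)
  finally show ?thesis .
qed

section \<open>Logarithm of a coordinate change of the plane\<close>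

lemma coeff2_add [simp]: "coeff2 (f + g) i j = coeff2 f i j + coeff2 g i j"
  by (simp add: coeff2_def)

lemma coeff2_diff [simp]: "coeff2 (f - g) i j = coeff2 f i j - coeff2 g i j"
  by (simp add: coeff2_def)

lemma coeff2_minus [simp]: "coeff2 (- f) i j = - coeff2 f i j"
  by (simp add: coeff2_def)

lemma coeff2_sum: "coeff2 (\<Sum>i\<in>I. f i) a b = (\<Sum>i\<in>I. coeff2 (f i) a b)"
  by (simp add: coeff2_def fps_sum_nth)

lemma coeff2_mult_low:
  "coeff2 (f * g) 0 0 = coeff2 f 0 0 * coeff2 g 0 0"
  "coeff2 (f * g) 1 0 = coeff2 f 1 0 * coeff2 g 0 0 + coeff2 f 0 0 * coeff2 g 1 0"
  "coeff2 (f * g) 0 1 = coeff2 f 0 1 * coeff2 g 0 0 + coeff2 f 0 0 * coeff2 g 0 1"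
  by (simp_all add: coeff2_def fps_mult_nth)

lemma coeff2_power_low:
  assumes "coeff2 f 0 0 = 0"
  shows "coeff2 (f ^ n) 0 0 = (if n = 0 then 1 else 0)"
    and "coeff2 (f ^ n) 1 0 = (if n = 1 then coeff2 f 1 0 else 0)"
    and "coeff2 (f ^ n) 0 1 = (if n = 1 then coeff2 f 0 1 else 0)"
proof -
  show 0: "coeff2 (f ^ n) 0 0 = (if n = 0 then 1 else 0)" for n
    by (cases n) (simp_all add: coeff2_1 coeff2_mult_low assms)
  show "coeff2 (f ^ n) 1 0 = (if n = 1 then coeff2 f 1 0 else 0)"
    by (cases n) (simp_all add: coeff2_1 coeff2_mult_low[unfolded One_nat_def] assms 0)
  show "coeff2 (f ^ n) 0 1 = (if n = 1 then coeff2 f 0 1 else 0)"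
    by (cases n) (simp_all add: coeff2_1 coeff2_mult_low[unfolded One_nat_def] assms 0)
qed

lemma sum_sum_linear_part:
  fixes c :: "nat \<Rightarrow> nat \<Rightarrow> 'a::comm_semiring_1"
  assumes "K \<ge> 1"
  shows "(\<Sum>i\<le>K. \<Sum>j\<le>K. c i j * (if i = 1 \<and> j = 0 then u else if i = 0 \<and> j = 1 then v else 0)) =
    c 1 0 * u + c 0 1 * v" (is "?l = _")
proof -
  have "?l = (\<Sum>i\<le>K. \<Sum>j\<le>K. (if i = 1 \<and> j = 0 then c i j * u else 0)) +
      (\<Sum>i\<le>K. \<Sum>j\<le>K. (if i = 0 \<and> j = 1 then c i j * v else 0))"
    unfolding sum.distrib[symmetric] by (intro sum.cong) auto
  also have "(\<Sum>i\<le>K. \<Sum>j\<le>K. (if i = 1 \<and> j = 0 then c i j * u else 0)) = c 1 0 * u"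
    using assms by (subst sum_sum_single[where a = 1 and b = 0]) auto
  also have "(\<Sum>i\<le>K. \<Sum>j\<le>K. (if i = 0 \<and> j = 1 then c i j * v else 0)) = c 0 1 * v"
    using assms by (subst sum_sum_single[where a = 0 and b = 1]) auto
  finally show ?thesis .
qed

text \<open>
  A finite sum replaces \<open>subst22\<close>: after pullback to a branch the two agree up to order \<open>K\<close>, and
  for the sum this follows from multiplicativity of the pullback alone.
\<close>

definition trunc_comp2 :: "nat \<Rightarrow> ser2 \<times> ser2 \<Rightarrow> ser2 \<Rightarrow> ser2" where
  "trunc_comp2 K \<sigma> f = (\<Sum>i\<le>K. \<Sum>j\<le>K. const2 (coeff2 f i j) * (fst \<sigma> ^ i * snd \<sigma> ^ j))"

text \<open>The operator \<open>S = \<sigma>\<^sup>* - 1\<close>, formed with the truncated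
  substitution.\<close>

definition step2 :: "nat \<Rightarrow> ser2 \<times> ser2 \<Rightarrow> ser2 \<Rightarrow> ser2" where
  "step2 K \<sigma> f = trunc_comp2 K \<sigma> f - f"

definition log2 :: "nat \<Rightarrow> ser2 \<times> ser2 \<Rightarrow> ser2 \<Rightarrow> ser2" where
  "log2 K \<sigma> f = (\<Sum>n=1..K. const2 (log_coeff n) * (step2 K \<sigma> ^^ n) f)"

text \<open>The linear part \<open>(x + b y, y)\<close> required in \<open>A_sub\<close>, stated on
  coefficients so that it passes to jets.\<close>

definition unipotent2 :: "complex \<Rightarrow> ser2 \<times> ser2 \<Rightarrow> bool" where
  "unipotent2 b \<sigma> \<longleftrightarrow>
     coeff2 (fst \<sigma>) 0 0 = 0 \<and> coeff2 (fst \<sigma>) 1 0 = 1 \<and> coeff2 (fst \<sigma>) 0 1 = b \<and>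
     coeff2 (snd \<sigma>) 0 0 = 0 \<and> coeff2 (snd \<sigma>) 1 0 = 0 \<and> coeff2 (snd \<sigma>) 0 1 = 1"

lemma coeff2_trunc_comp2_low:
  assumes "unipotent2 b \<sigma>" "K \<ge> 1"
  shows "coeff2 (trunc_comp2 K \<sigma> f) 0 0 = coeff2 f 0 0"
    and "coeff2 (trunc_comp2 K \<sigma> f) 1 0 = coeff2 f 1 0"
    and "coeff2 (trunc_comp2 K \<sigma> f) 0 1 = b * coeff2 f 1 0 + coeff2 f 0 1"
proof -
  have c: "coeff2 (fst \<sigma>) 0 0 = 0" "coeff2 (snd \<sigma>) 0 0 = 0"
    using assms by (auto simp: unipotent2_def)
  note low = coeff2_mult_low(1) coeff2_mult_low(2,3)[unfolded One_nat_def]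
    coeff2_power_low(1)[OF c(1)] coeff2_power_low(1)[OF c(2)]
    coeff2_power_low(2,3)[OF c(1), unfolded One_nat_def]
    coeff2_power_low(2,3)[OF c(2), unfolded One_nat_def]
  have "coeff2 (trunc_comp2 K \<sigma> f) 0 0 =
      (\<Sum>i\<le>K. \<Sum>j\<le>K. coeff2 f i j * (if i = 0 \<and> j = 0 then 1 else 0))"
    unfolding trunc_comp2_def coeff2_sum coeff2_const2_mult low
    by (intro sum.cong) (auto simp: coeff2_const2)
  also have "\<dots> = coeff2 f 0 0"
    by (subst sum_sum_single[where a = 0 and b = 0]) (auto simp: coeff2_const2)
  finally show "coeff2 (trunc_comp2 K \<sigma> f) 0 0 = coeff2 f 0 0" .
  have "coeff2 (trunc_comp2 K \<sigma> f) 1 0 = (\<Sum>i\<le>K. \<Sum>j\<le>K. coeff2 f i j *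
      (if i = 1 \<and> j = 0 then coeff2 (fst \<sigma>) 1 0 else if i = 0 \<and> j = 1 then coeff2 (snd \<sigma>) 1 0 else 0))"
    unfolding trunc_comp2_def coeff2_sum coeff2_const2_mult One_nat_def low
    by (intro sum.cong) (auto simp: coeff2_const2)
  then show "coeff2 (trunc_comp2 K \<sigma> f) 1 0 = coeff2 f 1 0"
    using assms by (simp only: sum_sum_linear_part) (simp add: unipotent2_def)
  have "coeff2 (trunc_comp2 K \<sigma> f) 0 1 = (\<Sum>i\<le>K. \<Sum>j\<le>K. coeff2 f i j *
      (if i = 1 \<and> j = 0 then coeff2 (fst \<sigma>) 0 1 else if i = 0 \<and> j = 1 then coeff2 (snd \<sigma>) 0 1 else 0))"
    unfolding trunc_comp2_def coeff2_sum coeff2_const2_mult One_nat_def low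
    by (intro sum.cong) (auto simp: coeff2_const2)
  then show "coeff2 (trunc_comp2 K \<sigma> f) 0 1 = b * coeff2 f 1 0 + coeff2 f 0 1"
    using assms by (simp only: sum_sum_linear_part) (simp add: unipotent2_def)
qed

lemma coeff2_step2_low:
  assumes "unipotent2 b \<sigma>" "K \<ge> 1"
  shows "coeff2 (step2 K \<sigma> f) 0 0 = 0"
    and "coeff2 (step2 K \<sigma> f) 1 0 = 0"
    and "coeff2 (step2 K \<sigma> f) 0 1 = b * coeff2 f 1 0"
  using coeff2_trunc_comp2_low[OF assms, of f] by (simp_all add: step2_def)

text \<open>One step sends a linear part \<open>\<alpha> x + \<beta> y\<close> to
  \<open>b \<alpha> y\<close>, and a second step kills it. Hence the only possible linear term of
  the logarithm is a multiple of \<open>y\<close>, absent when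
  \<open>b \<alpha> = 0\<close>.\<close>

lemma coeff2_log2_low:
  assumes "unipotent2 b \<sigma>" "K \<ge> 1"
  shows "coeff2 (log2 K \<sigma> f) 0 0 = 0"
    and "coeff2 (log2 K \<sigma> f) 1 0 = 0"
    and "b * coeff2 f 1 0 = 0 \<Longrightarrow> coeff2 (log2 K \<sigma> f) 0 1 = 0"
proof -
  note low = coeff2_step2_low[OF assms]
  have 0: "coeff2 ((step2 K \<sigma> ^^ n) f) 0 0 = 0" if "n \<in> {1..K}" for n
    using that by (cases n) (auto simp: low)
  have 1: "coeff2 ((step2 K \<sigma> ^^ n) f) 1 0 = 0" if "n \<in> {1..K}" for n
    using that by (cases n) (auto simp: low[unfolded One_nat_def])
  show "coeff2 (log2 K \<sigma> f) 0 0 = 0" "coeff2 (log2 K \<sigma> f) 1 0 = 0"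
    unfolding log2_def coeff2_sum coeff2_const2_mult
    by (intro sum.neutral ballI, simp only: 0 1 mult_zero_right)+
  assume b: "b * coeff2 f 1 0 = 0"
  have "coeff2 ((step2 K \<sigma> ^^ n) f) 0 1 = 0" if "n \<in> {1..K}" for n
  proof (cases n)
    case (Suc l)
    have "b * coeff2 ((step2 K \<sigma> ^^ l) f) 1 0 = 0"
      using b by (cases l) (auto simp: low[unfolded One_nat_def])
    then show ?thesis using Suc by (simp only: funpow.simps o_apply low)
  qed (use that in simp)
  then show "coeff2 (log2 K \<sigma> f) 0 1 = 0"
    unfolding log2_def coeff2_sum coeff2_const2_mult by (intro sum.neutral) auto
qed

section \<open>First order perturbations\<close>

text \<open>Modulo \<open>t\<^sup>k\<^sup>+\<^sup>1\<close> the power \<open>t\<^sup>k\<close> has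
  square zero and sees only constant terms of its cofactors, so the product rule involves only the
  values of \<open>a\<close> and \<open>c\<close> at 0.\<close>

lemma first_order_mult:
  fixes a a' c c' :: "complex fps"
  assumes "k \<ge> 1"
    and "fps_X ^ Suc k dvd a' - (a + fps_const \<alpha> * fps_X ^ k)"
    and "fps_X ^ Suc k dvd c' - (c + fps_const \<gamma> * fps_X ^ k)"
  shows "fps_X ^ Suc k dvd a' * c' -
    (a * c + fps_const (\<alpha> * fps_nth c 0 + \<gamma> * fps_nth a 0) * fps_X ^ k)"
proof -
  let ?X = "fps_X ^ k :: complex fps"
  have "fps_X ^ Suc k dvd a' * c' - (a + fps_const \<alpha> * ?X) * (c + fps_const \<gamma> * ?X)"
    using assms by (intro dvd_mult_diff)
  moreover have "fps_X ^ Suc k dvd (a + fps_const \<alpha> * ?X) * (c + fps_const \<gamma> * ?X) -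
      (a * c + fps_const (\<alpha> * fps_nth c 0 + \<gamma> * fps_nth a 0) * ?X)"
  proof -
    have id: "(a + A * X) * (c + C * X) - (a * c + (A * c0 + C * a0) * X) =
      X * (A * (c - c0) + C * (a - a0) + A * C * X)" for A C X a0 c0 :: "complex fps"
      by (simp add: algebra_simps)
    \<comment> \<open>The cofactor of \<open>t\<^sup>k\<close> has zero constant term; for its last
      summand this uses \<open>k \<ge> 1\<close>.\<close>
    have "fps_X ^ Suc k dvd ?X * (fps_const \<alpha> * (c - fps_const (fps_nth c 0)) +
        fps_const \<gamma> * (a - fps_const (fps_nth a 0)) + fps_const \<alpha> * fps_const \<gamma> * ?X)"
      unfolding power_Suc2 by (rule mult_dvd_mono) (use assms(1) in \<open>auto simp: X_dvd_iff\<close>)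
    then show ?thesis
      unfolding id[symmetric] by (simp only: fps_const_add fps_const_mult)
  qed
  ultimately show ?thesis by (rule dvd_diff_trans)
qed

text \<open>For \<open>n \<ge> 2\<close> the derivative of the power has a factor \<open>a\<close>,
  which vanishes at 0.\<close>

lemma first_order_power:
  fixes a a' :: "complex fps"
  assumes "k \<ge> 1" "fps_nth a 0 = 0"
    and "fps_X ^ Suc k dvd a' - (a + fps_const \<alpha> * fps_X ^ k)"
  shows "fps_X ^ Suc k dvd a' ^ n - (a ^ n + fps_const (if n = 1 then \<alpha> else 0) * fps_X ^ k)"
proof (induction n)
  case (Suc n)
  from first_order_mult[OF assms(1,3) Suc]
  have "fps_X ^ Suc k dvd a' * a' ^ n - (a * a ^ n +
      fps_const (\<alpha> * fps_nth (a ^ n) 0 + (if n = 1 then \<alpha> else 0) * fps_nth a 0) * fps_X ^ k)" .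
  moreover have "\<alpha> * fps_nth (a ^ n) 0 + (if n = 1 then \<alpha> else 0) * fps_nth a 0 = (if Suc n = 1 then \<alpha> else 0)"
    using assms(2) by (auto simp: fps_power_zeroth power_0_left)
  ultimately show ?case by (simp only: power_Suc)
qed simp

text \<open>Only the monomials \<open>x\<close> and \<open>y\<close> feel the perturbation, so the
  error depends on the linear part of \<open>f\<close>. The perturbed side is a finite sum because
  this is exactly the pullback of \<open>trunc_comp2\<close>.\<close>

lemma first_order_subst2:
  assumes "k \<ge> 1" "admissible q"
    and 1: "fps_X ^ Suc k dvd fst q' - (fst q + fps_const d1 * fps_X ^ k)"
    and 2: "fps_X ^ Suc k dvd snd q' - (snd q + fps_const d2 * fps_X ^ k)"
    and K: "K \<ge> k"
  shows "fps_X ^ Suc k dvd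
    (\<Sum>i\<le>K. \<Sum>j\<le>K. fps_const (coeff2 f i j) * (fst q' ^ i * snd q' ^ j)) -
    (subst2 f q + fps_const (coeff2 f 1 0 * d1 + coeff2 f 0 1 * d2) * fps_X ^ k)"
proof -
  let ?D = "\<lambda>i j. if i = 1 \<and> j = 0 then d1 else if i = 0 \<and> j = 1 then d2 else (0::complex)"
  have q0: "fps_nth (fst q) 0 = 0" "fps_nth (snd q) 0 = 0"
    using assms by (auto simp: admissible_def)
  have mono: "fps_X ^ Suc k dvd fst q' ^ i * snd q' ^ j -
      (fst q ^ i * snd q ^ j + fps_const (?D i j) * fps_X ^ k)" for i j
  proof -
    have "?D i j = (if i = 1 then d1 else 0) * fps_nth (snd q ^ j) 0 +
        (if j = 1 then d2 else 0) * fps_nth (fst q ^ i) 0"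
      using q0 by (auto simp: fps_power_zeroth power_0_left)
    then show ?thesis
      using first_order_mult[OF assms(1) first_order_power[OF assms(1) q0(1) 1, of i]
          first_order_power[OF assms(1) q0(2) 2, of j]] by simp
  qed
  have "(\<Sum>i\<le>K. \<Sum>j\<le>K. fps_const (coeff2 f i j) * (fst q' ^ i * snd q' ^ j)) -
      ((\<Sum>i\<le>K. \<Sum>j\<le>K. fps_const (coeff2 f i j) * (fst q ^ i * snd q ^ j)) +
       (\<Sum>i\<le>K. \<Sum>j\<le>K. fps_const (coeff2 f i j * ?D i j)) * fps_X ^ k) =
      (\<Sum>i\<le>K. \<Sum>j\<le>K. fps_const (coeff2 f i j) * (fst q' ^ i * snd q' ^ j -
      (fst q ^ i * snd q ^ j + fps_const (?D i j) * fps_X ^ k)))"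
    by (simp add: sum_distrib_right sum_subtractf sum.distrib ring_distribs mult.assoc
        flip: fps_const_mult)
  also have "fps_X ^ Suc k dvd \<dots>"
    by (intro dvd_sum dvd_mult mono)
  also have "(\<Sum>i\<le>K. \<Sum>j\<le>K. fps_const (coeff2 f i j * ?D i j)) =
      fps_const (\<Sum>i\<le>K. \<Sum>j\<le>K. coeff2 f i j * ?D i j)"
    by (simp add: fps_eq_iff fps_sum_nth)
  also have "(\<Sum>i\<le>K. \<Sum>j\<le>K. coeff2 f i j * ?D i j) = coeff2 f 1 0 * d1 + coeff2 f 0 1 * d2"
    using assms(1) K by (intro sum_sum_linear_part) simp
  finally have A: "fps_X ^ Suc k dvd
      (\<Sum>i\<le>K. \<Sum>j\<le>K. fps_const (coeff2 f i j) * (fst q' ^ i * snd q' ^ j)) -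
      ((\<Sum>i\<le>K. \<Sum>j\<le>K. fps_const (coeff2 f i j) * (fst q ^ i * snd q ^ j)) +
       fps_const (coeff2 f 1 0 * d1 + coeff2 f 0 1 * d2) * fps_X ^ k)" .
  have "fps_X ^ Suc k dvd subst2 f q - (\<Sum>i\<le>K. \<Sum>j\<le>K. fps_const (coeff2 f i j) * (fst q ^ i * snd q ^ j))"
    using X_power_dvd_mono[OF X_power_dvd_subst2_diff_sum[OF assms(2), of K f]] K
    by (simp del: power_Suc)
  from dvd_diff[OF A this] show ?thesis by (simp add: algebra_simps)
qed

text \<open>The image of \<open>p\<close> under \<open>\<sigma>\<close> agrees, up to
  reparametrization by \<open>r\<close>, with \<open>p\<close> perturbed by
  \<open>(d1, d2) t\<^sup>k\<close>. As \<open>r\<close> is tangent to the identity, the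
  perturbation keeps its form under composition with \<open>r\<close> modulo
  \<open>t\<^sup>k\<^sup>+\<^sup>1\<close>.\<close>

locale perturbed_branch =
  fixes p :: param and r :: "complex fps" and \<sigma> :: "ser2 \<times> ser2" and b d1 d2 :: complex and k :: nat
  assumes k: "k \<ge> 1"
    and adm: "admissible p"
    and r: "fps_nth r 0 = 0" "fps_nth r 1 = 1"
    and uni: "unipotent2 b \<sigma>"
    and image1: "fps_X ^ Suc k dvd subst2 (fst \<sigma>) p - ((fst p oo r) + fps_const d1 * fps_X ^ k)"
    and image2: "fps_X ^ Suc k dvd subst2 (snd \<sigma>) p - ((snd p oo r) + fps_const d2 * fps_X ^ k)"
begin

text \<open>The functional \<open>\<Delta>\<close> in
  \<open>P S = T P + \<Delta> t\<^sup>k\<close>.\<close>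

definition defect :: "ser2 \<Rightarrow> complex" where
  "defect f = coeff2 f 1 0 * d1 + coeff2 f 0 1 * d2"

lemma subst2_step2:
  "fps_X ^ Suc k dvd subst2 (step2 (Suc k) \<sigma> f) p -
     (comp_step r (subst2 f p) + fps_const (defect f) * fps_X ^ k)"
proof -
  let ?q' = "(subst2 (fst \<sigma>) p, subst2 (snd \<sigma>) p)" and ?q = "(fst p oo r, snd p oo r)"
  have "subst2 (trunc_comp2 (Suc k) \<sigma> f) p =
      (\<Sum>i\<le>Suc k. \<Sum>j\<le>Suc k. fps_const (coeff2 f i j) * (fst ?q' ^ i * snd ?q' ^ j))"
    unfolding trunc_comp2_def subst2_sum subst2_const2_mult fst_conv snd_conv
    by (simp only: subst2_mult[OF adm] subst2_power[OF adm])
  moreover have "fps_X ^ Suc k dvd \<dots> - (subst2 f ?q + fps_const (defect f) * fps_X ^ k)"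
    unfolding defect_def
    by (rule first_order_subst2) (use k adm r image1 image2 in \<open>auto simp: admissible_def\<close>)
  moreover have "subst2 f ?q = subst2 f p oo r"
    by (simp add: subst2_compose adm r)
  ultimately show ?thesis
    by (simp add: step2_def comp_step_def subst2_diff algebra_simps)
qed

text \<open>Each further \<open>T\<close> raises the earlier errors to order \<open>k + 1\<close>,
  so only the error of the last step survives.\<close>

lemma subst2_step2_funpow:
  "fps_X ^ Suc k dvd subst2 ((step2 (Suc k) \<sigma> ^^ Suc n) f) p -
     ((comp_step r ^^ Suc n) (subst2 f p) + fps_const (defect ((step2 (Suc k) \<sigma> ^^ n) f)) * fps_X ^ k)"
proof (induction n)
  case (Suc n)
  let ?S = "step2 (Suc k) \<sigma>" and ?T = "comp_step r"
  let ?g = "(?S ^^ Suc n) f" and ?h = "(?T ^^ Suc n) (subst2 f p)"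
  have "fps_X ^ k dvd subst2 ?g p - ?h"
  proof -
    have "subst2 ?g p - ?h = (subst2 ?g p - (?h + fps_const (defect ((?S ^^ n) f)) * fps_X ^ k)) +
        fps_const (defect ((?S ^^ n) f)) * fps_X ^ k"
      by simp
    also have "fps_X ^ k dvd \<dots>"
      by (intro dvd_add X_power_dvd_mono[OF Suc]) auto
    finally show ?thesis .
  qed
  then have "fps_X ^ Suc k dvd ?T (subst2 ?g p) - ?T ?h"
    unfolding comp_step_diff[symmetric] by (rule X_power_dvd_comp_step[OF r])
  from dvd_add[OF subst2_step2[of ?g] this] show ?case
    by (simp add: algebra_simps)
qed (use subst2_step2 in simp)

definition log_defect :: "ser2 \<Rightarrow> complex" where
  "log_defect f = (\<Sum>n=1..Suc k. log_coeff n * defect ((step2 (Suc k) \<sigma> ^^ (n - 1)) f))"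

text \<open>The iterates are summed with logarithm coefficients; \<open>comp_log_deriv\<close> then
  turns the part coming from \<open>T\<close> into \<open>\<epsilon> d/dt\<close> with
  \<open>\<epsilon> = comp_log (Suc k) r fps_X\<close>.\<close>

lemma subst2_log2:
  "fps_X ^ Suc k dvd subst2 (log2 (Suc k) \<sigma> f) p -
     (comp_log (Suc k) r fps_X * fps_deriv (subst2 f p) + fps_const (log_defect f) * fps_X ^ k)"
proof -
  define S T e where "S n = subst2 ((step2 (Suc k) \<sigma> ^^ n) f) p"
    and "T n = (comp_step r ^^ n) (subst2 f p)"
    and "e n = fps_const (defect ((step2 (Suc k) \<sigma> ^^ (n - 1)) f)) * fps_X ^ k" for n
  have S: "fps_X ^ Suc k dvd S n - (T n + e n)" if "n \<in> {1..Suc k}" for n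
  proof -
    from that obtain l where n: "n = Suc l" by (cases n) auto
    from subst2_step2_funpow[of l f] show ?thesis
      unfolding S_def T_def e_def n diff_Suc_1 .
  qed
  have "fps_X ^ Suc k dvd (\<Sum>n=1..Suc k. fps_const (log_coeff n) * (S n - (T n + e n)))"
    by (intro dvd_sum dvd_mult S)
  also have "\<dots> = (\<Sum>n=1..Suc k. fps_const (log_coeff n) * S n) -
      ((\<Sum>n=1..Suc k. fps_const (log_coeff n) * T n) + (\<Sum>n=1..Suc k. fps_const (log_coeff n) * e n))"
    by (simp only: right_diff_distrib distrib_left sum_subtractf sum.distrib)
  also have "(\<Sum>n=1..Suc k. fps_const (log_coeff n) * S n) = subst2 (log2 (Suc k) \<sigma> f) p"
    unfolding S_def log2_def subst2_sum subst2_const2_mult ..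
  also have "(\<Sum>n=1..Suc k. fps_const (log_coeff n) * T n) = comp_log (Suc k) r (subst2 f p)"
    unfolding T_def comp_log_def ..
  also have "(\<Sum>n=1..Suc k. fps_const (log_coeff n) * e n) = fps_const (log_defect f) * fps_X ^ k"
    unfolding e_def log_defect_def
    by (simp only: fps_eq_iff fps_sum_nth fps_mult_left_const_nth sum_distrib_right mult.assoc
        simp_thms)
  finally have "fps_X ^ Suc k dvd subst2 (log2 (Suc k) \<sigma> f) p -
      (comp_log (Suc k) r (subst2 f p) + fps_const (log_defect f) * fps_X ^ k)" .
  then show ?thesis by (rule dvd_diff_add_trans) (rule comp_log_deriv[OF r])
qed

lemma log_defect_eq:
  assumes "\<And>n. defect ((step2 (Suc k) \<sigma> ^^ Suc n) f) = 0"
  shows "log_defect f = defect f"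
proof -
  have z: "defect ((step2 (Suc k) \<sigma> ^^ (n - 1)) f) = 0" if "n \<in> {1..Suc k} - {1}" for n
  proof -
    from that obtain l where "n - 1 = Suc l" by (cases "n - 1") auto
    then show ?thesis by (simp only: assms)
  qed
  have "log_defect f = (\<Sum>n\<in>{1}. log_coeff n * defect ((step2 (Suc k) \<sigma> ^^ (n - 1)) f))"
    unfolding log_defect_def by (rule sum.mono_neutral_right) (use z in auto)
  then show ?thesis by (simp add: log_coeff_def)
qed

lemma defect_step2: "defect (step2 (Suc k) \<sigma> f) = b * coeff2 f 1 0 * d2"
  unfolding defect_def using coeff2_step2_low[OF uni, of "Suc k" f] by simp

text \<open>Neither \<open>y\<close> nor its iterates under \<open>S\<close> have an
  \<open>x\<close> term, so iteration creates no further defect.\<close>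

lemma log_defect_Y2: "log_defect Y2 = d2"
proof -
  have "coeff2 ((step2 (Suc k) \<sigma> ^^ n) Y2) 1 0 = 0" for n
    by (cases n) (simp_all add: coeff2_Y2 coeff2_step2_low[OF uni, unfolded One_nat_def])
  then have "log_defect Y2 = defect Y2"
    by (intro log_defect_eq) (simp only: funpow.simps o_apply defect_step2 mult_zero_right mult_zero_left)
  then show ?thesis by (simp add: defect_def coeff2_Y2)
qed

text \<open>\<open>S x\<close> may have the linear term \<open>b y\<close>, which shifts the defect
  by a multiple of \<open>b * d2\<close>; this is zero here.\<close>

lemma log_defect_X2:
  assumes "d2 = 0"
  shows "log_defect X2 = d1"
proof -
  have "defect (step2 (Suc k) \<sigma> f) = 0" for f
    unfolding defect_step2 by (simp add: assms)
  then have "log_defect X2 = defect X2"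
    by (intro log_defect_eq) (simp only: funpow.simps o_apply)
  then show ?thesis by (simp add: defect_def coeff2_X2)
qed

end

section \<open>The differential of a coordinate change\<close>

lemma coeff2_jet2: "coeff2 (jet2 k f) i j = (if i + j \<le> k then coeff2 f i j else 0)"
  by (simp add: jet2_def coeff2_def)

lemma X_power_dvd_subst2_jet2:
  assumes "admissible p"
  shows "fps_X ^ Suc k dvd subst2 f p - subst2 (jet2 k f) p"
  unfolding X_power_dvd_iff
proof (intro allI impI)
  fix n assume n: "n < Suc k"
  have "coeff2 (f - jet2 k f) i j * fps_nth (fst p ^ i * snd p ^ j) n = 0" for i j
  proof (cases "i + j \<le> k")
    case True
    then show ?thesis by (simp add: coeff2_jet2)
  next
    case False
    then have "fps_nth (fst p ^ i * snd p ^ j) n = 0"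
      using n assms by (intro nth_power_mult_power_eq_0) (auto simp: admissible_def)
    then show ?thesis by simp
  qed
  then have "fps_nth (subst2 (f - jet2 k f) p) n = 0"
    unfolding subst2_def fps_nth_Abs_fps by (simp only: sum.neutral_const)
  then show "fps_nth (subst2 f p - subst2 (jet2 k f) p) n = 0"
    by (simp only: subst2_diff)
qed

lemma conv2_if_polynomial:
  assumes "\<And>i j. i + j > K \<Longrightarrow> coeff2 f i j = 0"
  shows "f \<in> conv2"
proof -
  have "(\<lambda>(i, j). norm (coeff2 f i j) * 1 ^ (i + j)) summable_on UNIV \<longleftrightarrow>
      (\<lambda>(i, j). norm (coeff2 f i j) * 1 ^ (i + j)) summable_on ({..K} \<times> {..K})"
    by (rule summable_on_cong_neutral) (auto intro!: assms)
  then have "(\<lambda>(i, j). norm (coeff2 f i j) * 1 ^ (i + j)) summable_on UNIV"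
    by simp
  then show ?thesis unfolding conv2_def by (intro CollectI exI[of _ 1]) simp
qed

lemma max_ideal_sq_if_polynomial:
  assumes "\<And>i j. i + j > K \<Longrightarrow> coeff2 f i j = 0"
    and "coeff2 f 0 0 = 0" "coeff2 f 1 0 = 0" "coeff2 f 0 1 = 0"
  shows "f \<in> max_ideal_sq"
proof -
  \<comment> \<open>The monomials are sorted by their exponent of \<open>x\<close>: at least 2,
    exactly 1, and 0.\<close>
  define F G H where "F = fps_shift 2 f" and "G = fps_const (fps_shift 1 (fps_nth f 1))"
    and "H = fps_const (fps_shift 2 (fps_nth f 0))"
  have FGH: "F \<in> conv2" "G \<in> conv2" "H \<in> conv2"
    using assms(1) by (auto intro!: conv2_if_polynomial[of K] simp: F_def G_def H_def coeff2_def)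
  have 0: "fps_const fps_X ^ 2 * H = fps_const (fps_nth f 0)"
  proof -
    have "fps_X ^ 2 * fps_shift 2 (fps_nth f 0) = fps_nth f 0"
      using assms(2,4) by (auto simp: fps_eq_iff fps_X_power_mult_nth coeff2_def less_2_cases_iff)
        (intro arg_cong[where f = "fps_nth (fps_nth f 0)"], arith)
    then show ?thesis by (simp add: H_def fps_const_power)
  qed
  have 1: "fps_const fps_X * G = fps_const (fps_nth f 1)"
  proof -
    have "fps_X * fps_shift 1 (fps_nth f 1) = fps_nth f 1"
      using assms(3) by (auto simp: fps_eq_iff coeff2_def)
    then show ?thesis by (simp add: G_def)
  qed
  have "f = fps_X ^ 2 * F + fps_X * (fps_const fps_X * G) + fps_const fps_X ^ 2 * H"
    unfolding 0 1
  proof (rule fps_ext)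
    fix n
    show "fps_nth f n = fps_nth (fps_X ^ 2 * F + fps_X * fps_const (fps_nth f 1) + fps_const (fps_nth f 0)) n"
      by (cases "n = 0"; cases "n = 1") (auto simp: F_def fps_X_power_mult_nth,
        intro arg_cong[where f = "fps_nth f"], arith)
  qed
  then have "f = X2 ^ 2 * F + X2 * Y2 * G + Y2 ^ 2 * H"
    by (simp add: X2_def Y2_def mult.assoc)
  then show ?thesis using FGH by (auto simp: max_ideal_sq_def)
qed

text \<open>The differential \<open>D y dx - D x dy\<close>. Passing to jets makes its coefficients
  polynomials, hence convergent, and alters pullbacks only from order \<open>k + 2\<close>
  on.\<close>

definition log_form :: "nat \<Rightarrow> ser2 \<times> ser2 \<Rightarrow> ser2 \<times> ser2" where
  "log_form k \<sigma> = (jet2 (Suc k) (log2 (Suc k) \<sigma> Y2), - jet2 (Suc k) (log2 (Suc k) \<sigma> X2))"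

lemma log_form_in_Omega:
  assumes "unipotent2 b \<sigma>" "\<delta> \<in> {1, 2}" "\<delta> = 1 \<Longrightarrow> b = 0"
  shows "log_form k \<sigma> \<in> Omega \<delta>"
proof -
  let ?A = "jet2 (Suc k) (log2 (Suc k) \<sigma> Y2)" and ?B = "jet2 (Suc k) (log2 (Suc k) \<sigma> X2)"
  \<comment> \<open>The one linear term that can survive, coming from \<open>b\<close>, becomes the
    \<open>\<beta> y dy\<close> allowed in \<open>Omega\<close> when \<open>\<delta> = 2\<close>;
    for \<open>\<delta> = 1\<close> it vanishes together with \<open>b\<close>.\<close>
  define \<beta> where "\<beta> = - coeff2 ?B 0 1"
  have low: "coeff2 (log2 (Suc k) \<sigma> f) 0 0 = 0" "coeff2 (log2 (Suc k) \<sigma> f) (Suc 0) 0 = 0"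
    "b * coeff2 f 1 0 = 0 \<Longrightarrow> coeff2 (log2 (Suc k) \<sigma> f) 0 (Suc 0) = 0" for f
    using coeff2_log2_low[OF assms(1), of "Suc k" f] by auto
  have A: "?A \<in> max_ideal_sq"
    by (rule max_ideal_sq_if_polynomial[of "Suc k"]) (simp_all add: coeff2_jet2 low coeff2_Y2)
  have \<beta>: "\<beta> * of_nat (\<delta> - 1) = \<beta>"
    using assms(2,3) low(3)[of X2] by (auto simp: \<beta>_def coeff2_jet2)
  have "- ?B - const2 \<beta> * Y2 \<in> max_ideal_sq"
    by (rule max_ideal_sq_if_polynomial[of "Suc k"]) (auto simp: coeff2_jet2 low coeff2_Y2 \<beta>_def)
  moreover have "- ?B = const2 (\<beta> * of_nat (\<delta> - 1)) * Y2 + (- ?B - const2 \<beta> * Y2)"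
    unfolding \<beta> by simp
  ultimately show ?thesis using A unfolding log_form_def Omega_def by blast
qed

text \<open>The exponent \<open>k + m - 1\<close> compensates the 1 added in
  \<open>form_value\<close> and the subtracted multiplicity \<open>m\<close>.\<close>

lemma form_value_minus:
  assumes "fps_X ^ (k + m) dvd pullback \<omega> p - fps_const c * fps_X ^ (k + m - 1)" "m \<ge> 1"
  shows "c \<noteq> 0 \<Longrightarrow> form_value \<omega> p - enat m = enat k"
    and "c = 0 \<Longrightarrow> form_value \<omega> p - enat m > enat k"
proof -
  let ?f = "pullback \<omega> p"
  have nth: "fps_nth ?f i = (if i = k + m - 1 then c else 0)" if "i < k + m" for i
    using nth_eq_if_X_power_dvd_diff[OF assms(1) that] by simp
  {
    assume c: "c \<noteq> 0"
    have "subdegree ?f = k + m - 1"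
      using c assms(2) by (intro subdegreeI) (auto simp: nth)
    moreover have "?f \<noteq> 0" using nth[of "k + m - 1"] c assms(2) by auto
    ultimately show "form_value \<omega> p - enat m = enat k"
      using assms(2) by (simp add: form_value_def ord_def one_enat_def)
  }
  assume c: "c = 0"
  show "form_value \<omega> p - enat m > enat k"
  proof (cases "?f = 0")
    case True
    then show ?thesis by (simp add: form_value_def ord_def)
  next
    case False
    have "k + m \<le> subdegree ?f"
      using False by (intro subdegree_geI) (auto simp: nth c)
    then show ?thesis using False by (simp add: form_value_def ord_def one_enat_def)
  qed
qed

section \<open>Pullback of the form along a perturbed branch\<close>

context perturbed_branch
begin

text \<open>The contributions \<open>\<epsilon> y' x'\<close> and \<open>\<epsilon> x' y'\<close>
  cancel, which removes the reparametrization.\<close>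

lemma pullback_log_form:
  obtains U V where "pullback (log_form k \<sigma>) p =
    (fps_const d2 * fps_deriv (fst p) - fps_const (log_defect X2) * fps_deriv (snd p)) * fps_X ^ k +
    fps_X ^ Suc k * (U * fps_deriv (fst p) + V * fps_deriv (snd p))"
proof -
  let ?e = "comp_log (Suc k) r fps_X" and ?v = "log_defect X2"
  have ex: "\<exists>W. subst2 (jet2 (Suc k) (log2 (Suc k) \<sigma> f)) p =
      ?e * fps_deriv (subst2 f p) + fps_const (log_defect f) * fps_X ^ k + fps_X ^ Suc k * W" for f
  proof -
    have "fps_X ^ Suc k dvd subst2 (log2 (Suc k) \<sigma> f) p - subst2 (jet2 (Suc k) (log2 (Suc k) \<sigma> f)) p"
      by (rule X_power_dvd_mono[OF X_power_dvd_subst2_jet2[OF adm]]) simp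
    from dvd_diff[OF subst2_log2[of f] this] obtain W where
      "subst2 (log2 (Suc k) \<sigma> f) p -
       (?e * fps_deriv (subst2 f p) + fps_const (log_defect f) * fps_X ^ k) -
       (subst2 (log2 (Suc k) \<sigma> f) p - subst2 (jet2 (Suc k) (log2 (Suc k) \<sigma> f)) p) = fps_X ^ Suc k * W"
      by (rule dvdE)
    then show ?thesis by (intro exI[of _ W]) (simp add: algebra_simps del: power_Suc)
  qed
  from ex[of Y2] obtain U where U: "subst2 (jet2 (Suc k) (log2 (Suc k) \<sigma> Y2)) p =
      ?e * fps_deriv (snd p) + fps_const d2 * fps_X ^ k + fps_X ^ Suc k * U"
    by (auto simp only: subst2_Y2[OF adm] log_defect_Y2)
  from ex[of X2] obtain V where V: "subst2 (jet2 (Suc k) (log2 (Suc k) \<sigma> X2)) p =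
      ?e * fps_deriv (fst p) + fps_const ?v * fps_X ^ k + fps_X ^ Suc k * V"
    by (auto simp only: subst2_X2[OF adm])
  have "pullback (log_form k \<sigma>) p =
    (fps_const d2 * fps_deriv (fst p) - fps_const ?v * fps_deriv (snd p)) * fps_X ^ k +
    fps_X ^ Suc k * (U * fps_deriv (fst p) + (- V) * fps_deriv (snd p))"
    unfolding pullback_def log_form_def fst_conv snd_conv subst2_minus U V
    by (simp add: algebra_simps del: power_Suc)
  then show thesis by (rule that)
qed

text \<open>The shifted defect of \<open>x\<close> is multiplied by \<open>y'\<close>, of order at
  least \<open>m\<close>, so it stays above the lowest order \<open>k + m - 1\<close>.\<close>

lemma X_power_dvd_pullback_fst:
  assumes "fst p = fps_X ^ m" "fps_X ^ Suc m dvd snd p" "m \<ge> 1"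
  shows "fps_X ^ (k + m) dvd pullback (log_form k \<sigma>) p - fps_const (d2 * of_nat m) * fps_X ^ (k + m - 1)"
proof -
  obtain U V where *: "pullback (log_form k \<sigma>) p =
    (fps_const d2 * fps_deriv (fst p) - fps_const (log_defect X2) * fps_deriv (snd p)) * fps_X ^ k +
    fps_X ^ Suc k * (U * fps_deriv (fst p) + V * fps_deriv (snd p))"
    by (rule pullback_log_form)
  from assms obtain l where m: "m = Suc l" by (cases m) auto
  have x': "fps_deriv (fst p) = fps_const (of_nat m) * fps_X ^ l"
    by (auto simp: fps_eq_iff assms(1) m simp del: power_Suc)
  have y': "fps_X ^ Suc l dvd fps_deriv (snd p)"
    using X_power_dvd_deriv[OF assms(2)] by (simp only: m)
  have "pullback (log_form k \<sigma>) p - fps_const (d2 * of_nat m) * fps_X ^ (k + m - 1) =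
      fps_X ^ k * (fps_X * (U * fps_deriv (fst p)) + (fps_X * V - fps_const (log_defect X2)) * fps_deriv (snd p))"
    unfolding * by (simp add: x' m algebra_simps power_add flip: fps_const_mult)
  moreover have "fps_X ^ Suc l dvd fps_X * (U * fps_deriv (fst p))"
    by (simp add: x')
  ultimately show ?thesis
    by (simp add: power_add m mult_dvd_mono dvd_add y'[unfolded power_Suc])
qed

text \<open>Here the defect of \<open>x\<close> does enter the lowest term; \<open>d2 = 0\<close>
  guarantees that it is \<open>d1\<close> without a shift.\<close>

lemma X_power_dvd_pullback_snd:
  assumes "snd p = fps_X ^ m" "fps_X ^ Suc m dvd fst p" "m \<ge> 1" "d2 = 0"
  shows "fps_X ^ (k + m) dvd pullback (log_form k \<sigma>) p - fps_const (- d1 * of_nat m) * fps_X ^ (k + m - 1)"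
proof -
  obtain U V where *: "pullback (log_form k \<sigma>) p =
    (fps_const d2 * fps_deriv (fst p) - fps_const (log_defect X2) * fps_deriv (snd p)) * fps_X ^ k +
    fps_X ^ Suc k * (U * fps_deriv (fst p) + V * fps_deriv (snd p))"
    by (rule pullback_log_form)
  from assms obtain l where m: "m = Suc l" by (cases m) auto
  have y': "fps_deriv (snd p) = fps_const (of_nat m) * fps_X ^ l"
    by (auto simp: fps_eq_iff assms(1) m simp del: power_Suc)
  have x': "fps_X ^ Suc l dvd fps_deriv (fst p)"
    using X_power_dvd_deriv[OF assms(2)] by (simp only: m)
  have "pullback (log_form k \<sigma>) p - fps_const (- d1 * of_nat m) * fps_X ^ (k + m - 1) =
      fps_X ^ k * (fps_X * (V * fps_deriv (snd p)) + (fps_X * U) * fps_deriv (fst p))"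
  proof -
    have id: "(0 * F - D * (M * L)) * K + (fps_X * K) * (U * F + V * (M * L)) - (- (D * M)) * (K * L) =
        K * (fps_X * (V * (M * L)) + (fps_X * U) * F)" for F D M L K :: "complex fps"
      by (simp add: algebra_simps)
    show ?thesis
      using id[of "fps_deriv (fst p)" "fps_const d1" "fps_const (of_nat m)" "fps_X ^ l" "fps_X ^ k"]
      unfolding * log_defect_X2[OF assms(4)] y' by (simp add: m assms(4) power_add)
  qed
  moreover have "fps_X ^ Suc l dvd fps_X * (V * fps_deriv (snd p))"
    by (simp add: y')
  ultimately show ?thesis
    by (simp add: power_add m mult_dvd_mono dvd_add dvd_mult x'[unfolded power_Suc])
qed

end

section \<open>Comparison of two normal forms in one orbit\<close>

lemma fps_inv_tangent_to_identity:
  fixes r :: "complex fps"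
  assumes "fps_nth r 0 = 0" "fps_nth r 1 = 1"
  shows "fps_nth (fps_inv r) 0 = 0" "fps_nth (fps_inv r) 1 = 1"
proof -
  have inv: "fps_inv r oo r = fps_X" using assms by (intro fps_inv) auto
  show 0: "fps_nth (fps_inv r) 0 = 0"
    using arg_cong[OF inv, of "\<lambda>f. fps_nth f 0"] by simp
  show "fps_nth (fps_inv r) 1 = 1"
    using arg_cong[OF inv, of "\<lambda>f. fps_nth f 1"] assms 0 by (simp add: fps_compose_nth)
qed

text \<open>Composing with \<open>r\<close> undoes the inverse reparametrization contained in the
  action.\<close>

lemma act_param_compose:
  assumes "admissible p" "fps_nth r 0 = 0" "fps_nth r 1 = 1"
  shows "fst (act_param r \<sigma> p) oo r = subst2 (fst \<sigma>) p"
    and "snd (act_param r \<sigma> p) oo r = subst2 (snd \<sigma>) p"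
proof -
  let ?q = "(fst p oo fps_inv r, snd p oo fps_inv r)"
  note inv = fps_inv_tangent_to_identity[OF assms(2,3)]
  have "admissible ?q" using assms(1) by (simp add: admissible_def)
  moreover have "f oo fps_inv r oo r = f" for f
    using assms inv by (simp add: fps_compose_assoc[symmetric] fps_inv)
  ultimately have "subst2 \<eta> ?q oo r = subst2 \<eta> p" for \<eta>
    using assms by (simp add: subst2_compose)
  then show "fst (act_param r \<sigma> p) oo r = subst2 (fst \<sigma>) p"
    and "snd (act_param r \<sigma> p) oo r = subst2 (snd \<sigma>) p"
    by (simp_all add: act_param_def Let_def)
qed

text \<open>The parametrization is viewed as a perturbation of the zero one at order
  \<open>m\<close>, which makes this a case of \<open>first_order_subst2\<close>.\<close>

lemma subst2_nth_lowest:
  assumes "fps_X ^ m dvd fst p" "fps_X ^ m dvd snd p" "m \<ge> 1"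
  shows "fps_nth (subst2 \<eta> p) m = coeff2 \<eta> 1 0 * fps_nth (fst p) m + coeff2 \<eta> 0 1 * fps_nth (snd p) m"
proof -
  have p: "admissible p"
    using assms by (auto simp: admissible_def X_power_dvd_iff)
  have pert: "fps_X ^ Suc m dvd f - (0 + fps_const (fps_nth f m) * fps_X ^ m)"
    if "fps_X ^ m dvd f" for f :: "complex fps"
    using that by (auto simp: X_power_dvd_iff less_Suc_eq simp del: power_Suc)
  have "fps_X ^ Suc m dvd
    (\<Sum>i\<le>m. \<Sum>j\<le>m. fps_const (coeff2 \<eta> i j) * (fst p ^ i * snd p ^ j)) -
    (subst2 \<eta> (0, 0) + fps_const (coeff2 \<eta> 1 0 * fps_nth (fst p) m + coeff2 \<eta> 0 1 * fps_nth (snd p) m) * fps_X ^ m)"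
    using pert[OF assms(1)] pert[OF assms(2)] assms(3)
    by (intro first_order_subst2) (simp_all add: admissible_def del: power_Suc)
  from nth_eq_if_X_power_dvd_diff[OF dvd_diff_trans[OF X_power_dvd_subst2_diff_sum[OF p] this], of m]
  have "fps_nth (subst2 \<eta> p) m = fps_nth (subst2 \<eta> (0, 0)) m +
      (coeff2 \<eta> 1 0 * fps_nth (fst p) m + coeff2 \<eta> 0 1 * fps_nth (snd p) m)"
    by (simp only: fps_add_nth fps_mult_left_const_nth fps_X_power_nth) simp
  moreover have "fps_nth (subst2 \<eta> (0, 0)) m = 0"
    unfolding subst2_def fps_nth_Abs_fps fst_conv snd_conv
    using assms(3) by (intro sum.neutral ballI) (auto simp: power_0_left)
  ultimately show ?thesis by simp
qed

lemma X_power_compose_nth_same: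
  fixes s :: "complex fps"
  assumes "fps_nth s 0 = 0" "fps_nth s 1 = 1"
  shows "fps_nth (fps_X ^ m oo s) m = 1"
  using assms by (simp add: fps_X_power_compose startsby_zero_power_nth_same)

text \<open>The linear part of \<open>fst \<sigma>\<close> is \<open>x + b y\<close>, and
  \<open>y\<close> has order above \<open>m\<close> on the branch, so the leading coefficient 1 of
  \<open>x\<close> is kept.\<close>

lemma act_param_nth_mult_fst:
  assumes "fps_nth r 0 = 0" "fps_nth r 1 = 1" "unipotent2 b \<sigma>"
    and "fst p = fps_X ^ m" "fps_X ^ Suc m dvd snd p" "m \<ge> 1"
  shows "fps_nth (fst (act_param r \<sigma> p)) m = 1"
proof -
  let ?s = "fps_inv r"
  note s = fps_inv_tangent_to_identity[OF assms(1,2)]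
  have 1: "fps_X ^ m dvd fst p oo ?s"
    using s by (intro X_power_dvd_compose) (simp_all add: assms(4))
  have 2: "fps_X ^ Suc m dvd snd p oo ?s"
    using s assms(5) by (intro X_power_dvd_compose)
  have "fps_nth (snd p oo ?s) m = 0" using 2 by (auto simp: X_power_dvd_iff simp del: power_Suc)
  then show ?thesis
    using subst2_nth_lowest[of m "(fst p oo ?s, snd p oo ?s)" "fst \<sigma>"] 1 X_power_dvd_mono[OF 2, of m]
      assms X_power_compose_nth_same[OF s, of m]
    by (simp add: act_param_def unipotent2_def Let_def del: power_Suc)
qed

lemma act_param_nth_mult_snd:
  assumes "fps_nth r 0 = 0" "fps_nth r 1 = 1" "unipotent2 b \<sigma>"
    and "snd p = fps_X ^ m" "fps_X ^ Suc m dvd fst p" "m \<ge> 1"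
  shows "fps_nth (snd (act_param r \<sigma> p)) m = 1"
proof -
  let ?s = "fps_inv r"
  note s = fps_inv_tangent_to_identity[OF assms(1,2)]
  have 1: "fps_X ^ m dvd snd p oo ?s"
    using s by (intro X_power_dvd_compose) (simp_all add: assms(4))
  have 2: "fps_X ^ Suc m dvd fst p oo ?s"
    using s assms(5) by (intro X_power_dvd_compose)
  have "fps_nth (fst p oo ?s) m = 0" using 2 by (auto simp: X_power_dvd_iff simp del: power_Suc)
  then show ?thesis
    using subst2_nth_lowest[of m "(fst p oo ?s, snd p oo ?s)" "snd \<sigma>"] 1 X_power_dvd_mono[OF 2, of m]
      assms X_power_compose_nth_same[OF s, of m]
    by (simp add: act_param_def unipotent2_def Let_def del: power_Suc)
qed

definition same_jet :: "nat \<Rightarrow> param \<Rightarrow> param \<Rightarrow> bool" where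
  "same_jet c q q' \<longleftrightarrow> fps_X ^ Suc c dvd fst q - fst q' \<and> fps_X ^ Suc c dvd snd q - snd q'"

lemma perturbed_branch_if_same_jet:
  assumes "admissible p" "fps_nth r 0 = 0" "fps_nth r 1 = 1" "unipotent2 b \<sigma>"
    and q: "same_jet c q (act_param r \<sigma> p)" and k: "1 \<le> k" "k \<le> c"
    and d: "fps_X ^ Suc k dvd fst q - (fst p + fps_const d1 * fps_X ^ k)"
      "fps_X ^ Suc k dvd snd q - (snd p + fps_const d2 * fps_X ^ k)"
  shows "perturbed_branch p r \<sigma> b d1 d2 k"
proof -
  have *: "fps_X ^ Suc k dvd (a oo r) - ((f oo r) + fps_const d * fps_X ^ k)"
    if "fps_X ^ Suc k dvd g - (f + fps_const d * fps_X ^ k)" "fps_X ^ Suc c dvd g - a"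
    for f g a :: "complex fps" and d
  proof -
    have "fps_X ^ Suc k dvd a - g"
      using X_power_dvd_mono[OF that(2), of "Suc k"] k by (simp add: dvd_diff_commute)
    from dvd_diff_trans[OF this that(1)]
    have "fps_X ^ Suc k dvd (a oo r) - ((f + fps_const d * fps_X ^ k) oo r)"
      by (rule X_power_dvd_compose_diff) (rule assms)
    moreover have "fps_X ^ Suc k dvd ((f + fps_const d * fps_X ^ k) oo r) - ((f oo r) + fps_const d * fps_X ^ k)"
    proof -
      have "fps_X ^ Suc k dvd (fps_const d * fps_X ^ k oo r) - fps_const d * fps_X ^ k"
        by (rule X_power_dvd_diff_compose_X_plus) (use assms in auto)
      then show ?thesis by (simp add: fps_compose_add_distrib del: power_Suc)
    qed
    ultimately show ?thesis by (rule dvd_diff_trans)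
  qed
  show ?thesis
    using *[OF d(1), of "fst (act_param r \<sigma> p)"] *[OF d(2), of "snd (act_param r \<sigma> p)"] q assms
    unfolding act_param_compose[OF assms(1-3)] same_jet_def by unfold_locales auto
qed

lemma lead_comp_simps [simp]:
  "lead_comp (Suc 0) p = snd p" "lead_comp 2 p = fst p" "free_comp (Suc 0) p = fst p" "free_comp 2 p = snd p"
  by (simp_all add: lead_comp_def free_comp_def)

text \<open>The parameter \<open>d\<close> selects the component that is a pure power: the first
  branch always has \<open>d = 2\<close>, the second has \<open>d = \<delta>\<close>. As
  \<open>p\<close> and \<open>q\<close> share that power, their difference at order \<open>k\<close>
  lies in the free component alone.\<close>

lemma branch_value:
  assumes d: "d \<in> {1, 2}"
    and p: "admissible p" "lead_comp d p = fps_X ^ m" "\<And>j. j \<le> m \<Longrightarrow> fps_nth (free_comp d p) j = 0" "m \<ge> 1"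
    and g: "fps_nth r 0 = 0" "fps_nth r 1 = 1" "unipotent2 b \<sigma>"
    and q: "lead_comp d q = fps_X ^ m" "same_jet c q (act_param r \<sigma> p)"
    and k: "1 \<le> k" "k \<le> c"
    and agree: "\<And>i. i < k \<Longrightarrow> fps_nth (free_comp d q) i = fps_nth (free_comp d p) i"
  shows "fps_nth (free_comp d q) k \<noteq> fps_nth (free_comp d p) k \<Longrightarrow>
      form_value (log_form k \<sigma>) p - enat m = enat k"
    and "fps_nth (free_comp d q) k = fps_nth (free_comp d p) k \<Longrightarrow>
      form_value (log_form k \<sigma>) p - enat m > enat k"
proof -
  define e where "e = fps_nth (free_comp d q) k - fps_nth (free_comp d p) k"
  have free: "fps_X ^ Suc k dvd free_comp d q - (free_comp d p + fps_const e * fps_X ^ k)"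
    using agree by (auto simp: X_power_dvd_iff less_Suc_eq e_def simp del: power_Suc)
  have lead: "fps_X ^ Suc k dvd lead_comp d q - (lead_comp d p + fps_const 0 * fps_X ^ k)"
    using p q by simp
  have pm: "fps_X ^ Suc m dvd free_comp d p"
    using p by (auto simp: X_power_dvd_iff simp del: power_Suc)
  have "\<exists>c. (c = 0 \<longleftrightarrow> e = 0) \<and>
      fps_X ^ (k + m) dvd pullback (log_form k \<sigma>) p - fps_const c * fps_X ^ (k + m - 1)"
  proof (cases "d = 1")
    case True
    \<comment> \<open>The free component is the first one, so \<open>d2 = 0\<close>, as
      \<open>X_power_dvd_pullback_snd\<close> requires.\<close>
    interpret perturbed_branch p r \<sigma> b e 0 k
      by (rule perturbed_branch_if_same_jet[where q = q and c = c])
        (use p g q k free lead True in \<open>auto simp del: power_Suc\<close>)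
    show ?thesis
      using X_power_dvd_pullback_snd[of m] p pm True
      by (intro exI[of _ "- e * of_nat m"]) (auto simp del: power_Suc)
  next
    case False
    then have d2: "d = 2" using d by auto
    interpret perturbed_branch p r \<sigma> b 0 e k
      by (rule perturbed_branch_if_same_jet[where q = q and c = c])
        (use p g q k free lead d2 in \<open>auto simp del: power_Suc\<close>)
    show ?thesis
      using X_power_dvd_pullback_fst[of m] p pm d2
      by (intro exI[of _ "e * of_nat m"]) (auto simp del: power_Suc)
  qed
  then obtain c where c: "c = 0 \<longleftrightarrow> e = 0"
    "fps_X ^ (k + m) dvd pullback (log_form k \<sigma>) p - fps_const c * fps_X ^ (k + m - 1)"
    by blast
  show "fps_nth (free_comp d q) k \<noteq> fps_nth (free_comp d p) k \<Longrightarrow>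
      form_value (log_form k \<sigma>) p - enat m = enat k"
    using form_value_minus(1)[OF c(2) p(4)] c(1) by (simp add: e_def)
  show "fps_nth (free_comp d q) k = fps_nth (free_comp d p) k \<Longrightarrow>
      form_value (log_form k \<sigma>) p - enat m > enat k"
    using form_value_minus(2)[OF c(2) p(4)] c(1) by (simp add: e_def)
qed

text \<open>The image keeps coefficient 1 at order \<open>m\<close>, and \<open>m \<le> c\<close>
  makes this visible in the jet; a pure power with a nonzero coefficient there must be
  \<open>fps_X ^ m\<close>.\<close>

lemma lead_exponent_eq:
  assumes d: "d \<in> {1, 2}"
    and p: "lead_comp d p = fps_X ^ m" "\<And>j. j \<le> m \<Longrightarrow> fps_nth (free_comp d p) j = 0" "m \<ge> 1"
    and g: "fps_nth r 0 = 0" "fps_nth r 1 = 1" "unipotent2 b \<sigma>"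
    and q: "lead_comp d q = fps_X ^ m'" "same_jet c q (act_param r \<sigma> p)" "m \<le> c"
  shows "m' = m"
proof -
  have pm: "fps_X ^ Suc m dvd free_comp d p"
    using p by (auto simp: X_power_dvd_iff simp del: power_Suc)
  have "fps_nth (lead_comp d (act_param r \<sigma> p)) m = 1"
    using d act_param_nth_mult_fst[OF g, of p m] act_param_nth_mult_snd[OF g, of p m] p pm
    by (auto simp del: power_Suc)
  moreover have "fps_nth (lead_comp d q) m = fps_nth (lead_comp d (act_param r \<sigma> p)) m"
    using d q(2,3) by (auto simp: same_jet_def X_power_dvd_iff simp del: power_Suc)
  ultimately show ?thesis using q(1) by (auto split: if_splits)
qed

section \<open>Uniqueness of the normal form\<close>

lemma is_conductor_le:
  assumes "is_conductor \<Gamma> (c1, c2)" "is_conductor \<Gamma> (d1, d2)"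
  shows "c1 \<le> d1 \<and> c2 \<le> d2"
proof -
  have "\<forall>a\<ge>d1. \<forall>b\<ge>d2. (enat a, enat b) \<in> \<Gamma>"
    using assms(2) unfolding is_conductor_def prod.case by (rule conjunct1)
  moreover have "\<forall>d1 d2. (\<forall>a\<ge>d1. \<forall>b\<ge>d2. (enat a, enat b) \<in> \<Gamma>) \<longrightarrow> c1 \<le> d1 \<and> c2 \<le> d2"
    using assms(1) unfolding is_conductor_def prod.case by (rule conjunct2)
  note this[THEN spec, THEN spec, of d1 d2]
  ultimately show ?thesis by (rule rev_mp)
qed

lemma conductor_eq:
  assumes "is_conductor \<Gamma> (c1, c2)"
  shows "conductor \<Gamma> = (c1, c2)"
  unfolding conductor_def
proof (rule the_equality)
  fix d assume d: "is_conductor \<Gamma> d"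
  obtain d1 d2 where "d = (d1, d2)" by (cases d)
  then show "d = (c1, c2)"
    using is_conductor_le[OF assms, of d1 d2] is_conductor_le[of \<Gamma> d1 d2, OF _ assms] d by simp
qed (rule assms)

text \<open>Both branches are described by \<open>lead_comp\<close> and \<open>free_comp\<close>,
  the first with index 2. The fiber conditions extend to all \<open>j\<close>, because the free
  coefficients up to the multiplicity vanish.\<close>

lemma normal_formsD:
  assumes "(p1, p2) \<in> normal_forms \<delta> \<Gamma> L" "is_conductor \<Gamma> (c1, c2)" "\<delta> \<in> {1, 2}"
  shows "admissible p1" "admissible p2"
    and "lead_comp 2 p1 = fps_X ^ mult p1" "lead_comp \<delta> p2 = fps_X ^ mult p2"
    and "\<And>j. j \<le> mult p1 \<Longrightarrow> fps_nth (free_comp 2 p1) j = 0"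
    and "\<And>j. j \<le> mult p2 \<Longrightarrow> fps_nth (free_comp \<delta> p2) j = 0"
    and "1 \<le> mult p1" "mult p1 \<le> max c1 c2" "1 \<le> mult p2" "mult p2 \<le> max c1 c2"
    and "jetB (max c1 c2) (p1, p2) = (p1, p2)"
    and "Lambda \<delta> (p1, p2) = L"
    and "\<And>j. fps_nth (free_comp 2 p1) j \<noteq> 0 \<Longrightarrow> (j, j) \<notin> maximal_points L \<and> fiber1 L (j, j) = {}"
    and "\<And>j. fps_nth (free_comp \<delta> p2) j \<noteq> 0 \<Longrightarrow> fiber2 L (j, j) = {}"
proof -
  let ?c = "max c1 c2"
  have S: "(p1, p2) \<in> bigerms" "puiseux_form \<delta> (p1, p2)" "Lambda \<delta> (p1, p2) = L"
    and big: "\<And>n. n > ?c \<Longrightarrow> fps_nth (fst p1) n = 0 \<and> fps_nth (snd p1) n = 0 \<and>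
        fps_nth (fst p2) n = 0 \<and> fps_nth (snd p2) n = 0"
    and N1: "\<And>j. j > mult p1 \<Longrightarrow> fps_nth (snd p1) j \<noteq> 0 \<Longrightarrow> (j, j) \<notin> maximal_points L \<and> fiber1 L (j, j) = {}"
    and N2: "\<And>j. j > mult p2 \<Longrightarrow> fps_nth (free_comp \<delta> p2) j \<noteq> 0 \<Longrightarrow> fiber2 L (j, j) = {}"
    using assms(1) conductor_eq[OF assms(2)] by (auto simp: normal_forms_def puiseux_stratum_def)
  show adm: "admissible p1" "admissible p2"
    using S(1) by (auto simp: bigerms_def parametrizes_def params_def admissible_def)
  show lead: "lead_comp 2 p1 = fps_X ^ mult p1" "lead_comp \<delta> p2 = fps_X ^ mult p2"
    and free: "\<And>j. j \<le> mult p1 \<Longrightarrow> fps_nth (free_comp 2 p1) j = 0"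
      "\<And>j. j \<le> mult p2 \<Longrightarrow> fps_nth (free_comp \<delta> p2) j = 0"
    using S(2) by (auto simp: puiseux_form_def)
  have c0: "fps_nth (lead_comp 2 p1) 0 = 0" "fps_nth (lead_comp \<delta> p2) 0 = 0"
    using adm by (auto simp: lead_comp_def admissible_def)
  show "1 \<le> mult p1" "1 \<le> mult p2"
    using c0 unfolding lead by (auto simp: Suc_le_eq intro!: Nat.gr0I)
  \<comment> \<open>All terms beyond the conductor bound vanish, whereas the pure power has
    coefficient 1 at the multiplicity.\<close>
  have "n \<le> ?c" if "fps_nth (lead_comp d p1) n \<noteq> 0 \<or> fps_nth (lead_comp d p2) n \<noteq> 0" for n d
    using that big[of n] by (auto simp: lead_comp_def not_less[symmetric] split: if_splits)
  from this[of 2 "mult p1"] this[of \<delta> "mult p2"] show "mult p1 \<le> ?c" "mult p2 \<le> ?c"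
    unfolding lead by auto
  have "jet1 ?c f = f" if "\<And>n. n > ?c \<Longrightarrow> fps_nth f n = 0" for f
    using that by (auto simp: jet1_def fps_eq_iff less_Suc_eq_le not_le)
  then show "jetB ?c (p1, p2) = (p1, p2)"
    using big by (cases p1; cases p2) (auto simp: jetB_def)
  show "Lambda \<delta> (p1, p2) = L" by (rule S)
  show "(j, j) \<notin> maximal_points L \<and> fiber1 L (j, j) = {}" if "fps_nth (free_comp 2 p1) j \<noteq> 0" for j
    using that free(1)[of j] N1[of j] by (cases "j \<le> mult p1") simp_all
  show "fiber2 L (j, j) = {}" if "fps_nth (free_comp \<delta> p2) j \<noteq> 0" for j
    using that free(2)[of j] N2[of j] by (cases "j \<le> mult p2") simp_all
qed

text \<open>Since \<open>c \<ge> 1\<close>, truncation preserves the linear parts, and these are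
  what the uniqueness argument takes from a group element.\<close>

lemma A_jetsE:
  assumes "g \<in> A_jets c \<delta>" "c \<ge> 1"
  obtains r1 r2 \<sigma> b where "g = (r1, r2, \<sigma>)" "unipotent2 b \<sigma>" "\<delta> = 1 \<Longrightarrow> b = 0"
    "fps_nth r1 0 = 0" "fps_nth r1 1 = 1" "fps_nth r2 0 = 0" "fps_nth r2 1 = 1"
proof -
  from assms(1) obtain h where h: "h \<in> A_sub \<delta>" "g = jetA c h"
    unfolding A_jets_def by blast
  obtain r1 r2 s1 s2 where h': "h = (r1, r2, (s1, s2))" by (metis prod_cases4)
  have g: "g = (jet1 c r1, jet1 c r2, (jet2 c s1, jet2 c s2))"
    unfolding h(2) h' by (simp only: jetA_def prod.case)
  have r: "jet1 1 r1 = fps_X" "jet1 1 r2 = fps_X" and s2: "jet2 1 s2 = Y2"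
    and ex: "\<exists>b. (\<delta> = 1 \<longrightarrow> b = 0) \<and> jet2 1 s1 = X2 + const2 b * Y2"
    using h(1) unfolding h' A_sub_def mem_Collect_eq prod.case by blast+
  from ex obtain b where b: "\<delta> = 1 \<Longrightarrow> b = 0" and s1: "jet2 1 s1 = X2 + const2 b * Y2"
    by blast
  note s = s1 s2
  have R: "fps_nth (jet1 c r) 0 = 0 \<and> fps_nth (jet1 c r) 1 = 1" if "jet1 1 r = fps_X" for r
    using assms(2) arg_cong[OF that, of "\<lambda>f. fps_nth f 0"] arg_cong[OF that, of "\<lambda>f. fps_nth f 1"]
    by (simp add: jet1_def)
  have "unipotent2 b (jet2 c s1, jet2 c s2)"
    using assms(2) arg_cong[OF s(1), of "\<lambda>f. coeff2 f 0 0"] arg_cong[OF s(1), of "\<lambda>f. coeff2 f 1 0"]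
      arg_cong[OF s(1), of "\<lambda>f. coeff2 f 0 1"] arg_cong[OF s(2), of "\<lambda>f. coeff2 f 0 0"]
      arg_cong[OF s(2), of "\<lambda>f. coeff2 f 1 0"] arg_cong[OF s(2), of "\<lambda>f. coeff2 f 0 1"]
    by (simp add: unipotent2_def coeff2_jet2 coeff2_X2 coeff2_Y2)
  then show thesis using that[OF g] b R[OF r(1)] R[OF r(2)] by blast
qed

section \<open>The identity as an element of the jet group\<close>

lemma subst22_X2: "subst22 X2 (X2, Y2) = X2"
proof (intro fps_ext)
  fix k l
  have "fps_nth (fps_nth (subst22 X2 (X2, Y2)) k) l =
      (\<Sum>i\<le>k + l. \<Sum>j\<le>k + l. coeff2 X2 i j * coeff2 (X2 ^ i * Y2 ^ j) k l)"
    by (simp add: subst22_def)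
  also have "\<dots> = coeff2 X2 k l"
  proof (cases "k + l = 0")
    case False
    then show ?thesis
      by (subst sum_sum_single[where a = 1 and b = 0]) (auto simp: coeff2_X2)
  qed (simp add: coeff2_X2)
  finally show "fps_nth (fps_nth (subst22 X2 (X2, Y2)) k) l = fps_nth (fps_nth X2 k) l"
    by (simp add: coeff2_def)
qed

lemma subst22_Y2: "subst22 Y2 (X2, Y2) = Y2"
proof (intro fps_ext)
  fix k l
  have "fps_nth (fps_nth (subst22 Y2 (X2, Y2)) k) l =
      (\<Sum>i\<le>k + l. \<Sum>j\<le>k + l. coeff2 Y2 i j * coeff2 (X2 ^ i * Y2 ^ j) k l)"
    by (simp add: subst22_def)
  also have "\<dots> = coeff2 Y2 k l"
  proof (cases "k + l = 0")
    case False
    then show ?thesis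
      by (subst sum_sum_single[where a = 0 and b = 1]) (auto simp: coeff2_Y2)
  qed (simp add: coeff2_Y2)
  finally show "fps_nth (fps_nth (subst22 Y2 (X2, Y2)) k) l = fps_nth (fps_nth Y2 k) l"
    by (simp add: coeff2_def)
qed

text \<open>This puts a normal form into its own orbit, the easy inclusion of the theorem.\<close>

lemma identity_in_A_jets:
  assumes "c \<ge> 1"
  shows "(fps_X, fps_X, (X2, Y2)) \<in> A_jets c \<delta>"
proof -
  have jet1_X: "jet1 n fps_X = fps_X" if "n \<ge> 1" for n
    using that by (auto simp: jet1_def fps_eq_iff)
  have jet2_XY: "jet2 n X2 = X2" "jet2 n Y2 = Y2" if "n \<ge> 1" for n
    using that by (auto simp: jet2_def fps_eq_iff coeff2_X2 coeff2_Y2 coeff2_def[symmetric])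
  have "fps_X \<in> Aut1"
    unfolding Aut1_def conv1_def by (auto intro!: bexI[of _ fps_X])
  moreover have "X2 \<in> conv2" "Y2 \<in> conv2"
    by (auto intro!: conv2_if_polynomial[of 1] simp: coeff2_X2 coeff2_Y2)
  then have "(X2, Y2) \<in> Aut2"
    unfolding Aut2_def maps2_def
    by (auto intro!: exI[of _ "(X2, Y2)"]
        simp: comp22_def subst22_X2 subst22_Y2 coeff2_X2 coeff2_Y2 Bex_def simp del: split_paired_Ex)
  moreover have "const2 0 * Y2 = 0" by (simp add: const2_def)
  ultimately have "(fps_X, fps_X, (X2, Y2)) \<in> A_sub \<delta>"
    unfolding A_sub_def A_group_def by (auto simp: jet1_X jet2_XY intro!: exI[of _ 0])
  moreover have "jetA c (fps_X, fps_X, (X2, Y2)) = (fps_X, fps_X, (X2, Y2))"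
    using assms by (simp add: jetA_def jet1_X jet2_XY)
  ultimately show ?thesis unfolding A_jets_def by force
qed

lemma act_param_identity:
  assumes "admissible p"
  shows "act_param fps_X (X2, Y2) p = p"
proof -
  have "fps_inv fps_X = (fps_X :: complex fps)"
    using fps_inv[of "fps_X :: complex fps"] by simp
  then show ?thesis
    using assms by (simp add: act_param_def Let_def subst2_X2 subst2_Y2)
qed

lemma jetB_fixed_nth_eq_0:
  assumes "jetB c (x1, x2) = (x1, x2)" "k > c"
  shows "fps_nth (free_comp d x1) k = 0" "fps_nth (free_comp d x2) k = 0"
proof -
  have z: "fps_nth f k = 0" if "jet1 c f = f" for f
    using arg_cong[OF that, of "\<lambda>f. fps_nth f k"] assms(2) by (simp add: jet1_def)
  obtain a b a' b' where x: "x1 = (a, b)" "x2 = (a', b')" by (metis surj_pair)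
  from assms(1) have J: "((jet1 c a, jet1 c b), (jet1 c a', jet1 c b')) = ((a, b), (a', b'))"
    unfolding x by (simp only: jetB_def prod.case)
  have "jet1 c a = a" "jet1 c b = b" "jet1 c a' = a'" "jet1 c b' = b'"
    using arg_cong[OF J, of "\<lambda>u. fst (fst u)"] arg_cong[OF J, of "\<lambda>u. snd (fst u)"]
      arg_cong[OF J, of "\<lambda>u. fst (snd u)"] arg_cong[OF J, of "\<lambda>u. snd (snd u)"]
    by (simp_all only: fst_conv snd_conv)
  note this[THEN z]
  then show "fps_nth (free_comp d x1) k = 0" "fps_nth (free_comp d x2) k = 0"
    by (simp_all add: x free_comp_def)
qed

theorem mainTheorem3:
  fixes \<delta> c1 c2 c :: nat and \<Gamma> L :: "(enat \<times> enat) set" and \<phi> :: bigerm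
  assumes "\<delta> \<in> {1, 2}"
    and "is_conductor \<Gamma> (c1, c2)"
    and "c = max c1 c2"
    and "\<phi> \<in> normal_forms \<delta> \<Gamma> L"
  shows "jetB c ` normal_forms \<delta> \<Gamma> L \<inter> jet_orbit c \<delta> (jetB c \<phi>) = {jetB c \<phi>}"
proof -
  obtain p1 p2 where \<phi>: "\<phi> = (p1, p2)" by (cases \<phi>)
  note P = normal_formsD[OF assms(4)[unfolded \<phi>] assms(2,1), folded assms(3)]
  have c: "c \<ge> 1" using P(7,8) by simp
  \<comment> \<open>Normal forms have no terms beyond order \<open>c\<close>, so they are their own
    jets and uniqueness can be argued for bigerms.\<close>
  have jet\<phi>: "jetB c \<phi> = \<phi>" using P(11) by (simp add: \<phi>)
  have unique: "\<psi> = \<phi>" if \<psi>N: "\<psi> \<in> normal_forms \<delta> \<Gamma> L" and orbit: "\<psi> \<in> jet_orbit c \<delta> \<phi>" for \<psi>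
  proof -
    obtain q1 q2 where \<psi>: "\<psi> = (q1, q2)" by (cases \<psi>)
    note Q = normal_formsD[OF \<psi>N[unfolded \<psi>] assms(2,1), folded assms(3)]
    from orbit obtain g where g: "g \<in> A_jets c \<delta>" "\<psi> = jetB c (act g \<phi>)"
      by (auto simp: jet_orbit_def jet_act_def)
    obtain r1 r2 \<sigma> b where g': "g = (r1, r2, \<sigma>)" "unipotent2 b \<sigma>" "\<delta> = 1 \<Longrightarrow> b = 0"
      "fps_nth r1 0 = 0" "fps_nth r1 1 = 1" "fps_nth r2 0 = 0" "fps_nth r2 1 = 1"
      using A_jetsE[OF g(1) c] by metis
    have "same_jet c (jet1 c f, jet1 c h) (f, h)" for f h
      by (auto simp: same_jet_def jet1_def X_power_dvd_iff simp del: power_Suc)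
    then have J: "same_jet c q1 (act_param r1 \<sigma> p1)" "same_jet c q2 (act_param r2 \<sigma> p2)"
      using g(2) unfolding \<psi> \<phi> g'(1) act_def jetB_def
      by (auto split: prod.splits)
    have two: "2 \<in> {1, 2::nat}" by simp
    \<comment> \<open>Once the multiplicities agree, so do the pure powers, and only the free
      components can differ.\<close>
    have m1: "mult q1 = mult p1"
      by (rule lead_exponent_eq[OF two P(3) P(5) P(7) g'(4,5,2) Q(3) J(1) P(8)])
    have m2: "mult q2 = mult p2"
      by (rule lead_exponent_eq[OF assms(1) P(4) P(6) P(9) g'(6,7,2) Q(4) J(2) P(10)])
    have free: "free_comp 2 q1 = free_comp 2 p1 \<and> free_comp \<delta> q2 = free_comp \<delta> p2"
    proof (rule ccontr)
      let ?D = "\<lambda>i. fps_nth (free_comp 2 q1) i \<noteq> fps_nth (free_comp 2 p1) i \<or>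
          fps_nth (free_comp \<delta> q2) i \<noteq> fps_nth (free_comp \<delta> p2) i"
      assume "\<not> ?thesis"
      then have ex: "\<exists>i. ?D i" by (auto simp: fps_eq_iff)
      \<comment> \<open>The first order at which the free component of either branch
        differs.\<close>
      define k where "k = (LEAST i. ?D i)"
      have Dk: "?D k" unfolding k_def using ex by (rule LeastI_ex)
      have below: "\<not> ?D i" if "i < k" for i
        using not_less_Least[of i ?D] that unfolding k_def by blast
      have "k \<noteq> 0"
      proof
        assume "k = 0"
        then show False using Dk P(5)[of 0] P(6)[of 0] Q(5)[of 0] Q(6)[of 0] by simp
      qed
      then have k1: "1 \<le> k" by simp
      have kc: "k \<le> c"
      proof (rule ccontr)
        assume "\<not> k \<le> c"
        then have "k > c" by simp
        then show False
          using Dk jetB_fixed_nth_eq_0[OF P(11)] jetB_fixed_nth_eq_0[OF Q(11)] by (simp del: lead_comp_simps)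
      qed
      define v1 v2 where "v1 = form_value (log_form k \<sigma>) p1 - enat (mult p1)"
        and "v2 = form_value (log_form k \<sigma>) p2 - enat (mult p2)"
      \<comment> \<open>The form depends on \<open>k\<close> and \<open>\<sigma>\<close> but not on
        \<open>r1\<close> or \<open>r2\<close>, so both values come from one differential and form a
        point of \<open>L\<close>.\<close>
      have "log_form k \<sigma> \<in> Omega \<delta>"
        by (rule log_form_in_Omega[OF g'(2) assms(1) g'(3)])
      then have vL: "(v1, v2) \<in> L"
        unfolding P(12)[symmetric] Lambda_def v1_def v2_def prod.case by blast
      have b1: "fps_nth (free_comp 2 q1) i = fps_nth (free_comp 2 p1) i"
        and b2: "fps_nth (free_comp \<delta> q2) i = fps_nth (free_comp \<delta> p2) i" if "i < k" for i
        using below[OF that] by auto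
      note B1 = branch_value[OF two P(1,3,5,7) g'(4,5,2) Q(3)[unfolded m1] J(1) k1 kc b1]
      note B2 = branch_value[OF assms(1) P(2,4,6,9) g'(6,7,2) Q(4)[unfolded m2] J(2) k1 kc b2]
      have V1: "fps_nth (free_comp 2 q1) k \<noteq> fps_nth (free_comp 2 p1) k \<Longrightarrow> v1 = enat k"
        "fps_nth (free_comp 2 q1) k = fps_nth (free_comp 2 p1) k \<Longrightarrow> v1 > enat k"
        unfolding v1_def by (rule B1(1), assumption+) (rule B1(2), assumption+)
      have V2: "fps_nth (free_comp \<delta> q2) k \<noteq> fps_nth (free_comp \<delta> p2) k \<Longrightarrow> v2 = enat k"
        "fps_nth (free_comp \<delta> q2) k = fps_nth (free_comp \<delta> p2) k \<Longrightarrow> v2 > enat k"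
        unfolding v2_def by (rule B2(1), assumption+) (rule B2(2), assumption+)
      show False
      proof (cases "fps_nth (free_comp 2 q1) k = fps_nth (free_comp 2 p1) k")
        \<comment> \<open>Only the second branch differs, so \<open>v1 > k\<close> and
          \<open>v2 = k\<close>. Whichever of the two normal forms has a nonzero coefficient at
          \<open>k\<close> forces the fiber containing this point to be empty.\<close>
        case True
        then have ne: "fps_nth (free_comp \<delta> q2) k \<noteq> fps_nth (free_comp \<delta> p2) k" using Dk by auto
        then have "fps_nth (free_comp \<delta> q2) k \<noteq> 0 \<or> fps_nth (free_comp \<delta> p2) k \<noteq> 0" by auto
        then have "fiber2 L (k, k) = {}" using P(14)[of k] Q(14)[of k] by blast
        moreover have "(v1, v2) \<in> fiber2 L (k, k)"
          using vL V1(2)[OF True] V2(1)[OF ne] by (simp add: fiber2_def)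
        ultimately show False by simp
      next
        \<comment> \<open>Now \<open>v1 = k\<close>. The empty first fiber rules out
          \<open>v2 > k\<close>, so the second branch differs too and its fiber is empty as well;
          then \<open>(k, k)\<close> is a maximal point, which the first branch excludes.\<close>
        case False
        then have "fps_nth (free_comp 2 q1) k \<noteq> 0 \<or> fps_nth (free_comp 2 p1) k \<noteq> 0" by auto
        then have F: "(k, k) \<notin> maximal_points L" "fiber1 L (k, k) = {}"
          using P(13)[of k] Q(13)[of k] by blast+
        have v1: "v1 = enat k" by (rule V1(1)[OF False])
        have ne: "fps_nth (free_comp \<delta> q2) k \<noteq> fps_nth (free_comp \<delta> p2) k"
        proof
          assume "fps_nth (free_comp \<delta> q2) k = fps_nth (free_comp \<delta> p2) k"
          then have "(v1, v2) \<in> fiber1 L (k, k)"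
            using vL v1 V2(2) by (simp add: fiber1_def)
          then show False using F by simp
        qed
        then have "fps_nth (free_comp \<delta> q2) k \<noteq> 0 \<or> fps_nth (free_comp \<delta> p2) k \<noteq> 0" by auto
        then have "fiber2 L (k, k) = {}" using P(14)[of k] Q(14)[of k] by blast
        then have "(k, k) \<in> maximal_points L"
          using vL v1 V2(1)[OF ne] F by (simp add: maximal_points_def)
        then show False using F by simp
      qed
    qed
    have "q1 = p1"
      using P(3) Q(3) m1 free by (simp add: prod_eq_iff)
    moreover have "q2 = p2"
      using P(4) Q(4) m2 free assms(1) by (auto simp: prod_eq_iff)
    ultimately show ?thesis by (simp add: \<phi> \<psi>)
  qed
  have "act (fps_X, fps_X, (X2, Y2)) \<phi> = \<phi>"
    by (simp add: \<phi> act_def act_param_identity P(1,2))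
  then have "\<phi> \<in> jet_orbit c \<delta> \<phi>"
    unfolding jet_orbit_def jet_act_def using identity_in_A_jets[OF c] jet\<phi> by force
  moreover have "jetB c \<psi> = \<psi>" if "\<psi> \<in> normal_forms \<delta> \<Gamma> L" for \<psi>
    using that normal_formsD(11)[OF _ assms(2,1)] assms(3) by (cases \<psi>) auto
  ultimately show ?thesis
    using unique assms(4) by (auto simp: jet\<phi> intro!: rev_image_eqI[OF assms(4)])
qed

end
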